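(* Let $D$ be a weakly locally finite division ring with center $F$. If for all $a,b\in D^*$ there is a positive integer $n$ with $(aba^{-1}b^{-1})^n\in F$, then $D$ is commutative.
   Context: A division ring $D$ is weakly locally finite if for every finite subset $S\subseteq D$, the division subring generated by $S$ is finite dimensional over its own center. *)

theory Defs
  imports Main
begin

definition center :: "'a::division_ring set" where
  "center = {z. \<forall>x. z * x = x * z}"

definition is_division_subring :: "'a::division_ring set \<Rightarrow> bool" where
  "is_division_subring K \<longleftrightarrow> 0 \<in> K \<and> 1 \<in> K \<and>
     (\<forall>x\<in>K. \<forall>y\<in>K. x + y \<in> K \<and> x * y \<in> K) \<and>
     (\<forall>x\<in>K. - x \<in> K) \<and> (\<forall>x\<in>K. x \<noteq> 0 \<longrightarrow> inverse x \<in> K)"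

definition div_subring_gen :: "'a::division_ring set \<Rightarrow> 'a set" where
  "div_subring_gen S = \<Inter> {K. is_division_subring K \<and> S \<subseteq> K}"

definition rel_center :: "'a::division_ring set \<Rightarrow> 'a set" where
  "rel_center K = {z\<in>K. \<forall>x\<in>K. z * x = x * z}"

definition fin_dim_over_center :: "'a::division_ring set \<Rightarrow> bool" where
  "fin_dim_over_center K \<longleftrightarrow> (\<exists>B. finite B \<and> B \<subseteq> K \<and>
     (\<forall>x\<in>K. \<exists>c. (\<forall>b\<in>B. c b \<in> rel_center K) \<and> x = (\<Sum>b\<in>B. c b * b)))"

definition weakly_locally_finite :: "'a::division_ring itself \<Rightarrow> bool" where
  "weakly_locally_finite _ \<longleftrightarrow>
     (\<forall>S::'a set. finite S \<longrightarrow> fin_dim_over_center (div_subring_gen S))"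

end

theory Submission
  imports Defs "Jordan_Normal_Form.Char_Poly"
begin

text \<open>
  Let \<open>K\<close> be the division subring generated by two non-commuting elements. It is finite-dimensional
  over its center \<open>Z\<close>, so the determinant of left multiplication is a norm \<open>K \<rightarrow> Z\<close>, which is \<open>1\<close> on
  commutators and a power map on \<open>Z\<close>; hence a commutator with a power in \<open>Z\<close> has finite order.
  Some commutator \<open>u\<close> is not in \<open>Z\<close>. Decomposing \<open>K\<close> under the finite-order operator
  \<open>w \<mapsto> u w u\<^sup>-\<^sup>1\<close> gives \<open>g\<close> with \<open>g u g\<^sup>-\<^sup>1 = u\<^sup>j \<noteq> u\<close>, and then \<open>(\<lambda> + u\<^sup>j) / (\<lambda> + u)\<close>, a commutator of
  \<open>g\<close> and \<open>\<lambda> + u\<close>, is a root of unity for every \<open>\<lambda> \<in> Z\<close>.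

  In characteristic \<open>0\<close>, \<open>(1 + 3 u\<^sup>j) / (1 + 3 u)\<close> is a root of unity congruent to \<open>1\<close> modulo \<open>3\<close>, hence
  equal to \<open>1\<close>, a contradiction. In characteristic \<open>p\<close>, solving for \<open>\<lambda>\<close> shows that \<open>Z\<close> is algebraic over
  the prime field, so \<open>g\<close> has finite order and \<open>u\<close>, \<open>g\<close> generate a finite non-commutative division
  ring, against Wedderburn's little theorem.
\<close>

section \<open>Division subrings\<close>

lemma division_subringD:
  assumes "is_division_subring K"
  shows "0 \<in> K" "1 \<in> K" "x \<in> K \<Longrightarrow> y \<in> K \<Longrightarrow> x + y \<in> K" "x \<in> K \<Longrightarrow> y \<in> K \<Longrightarrow> x * y \<in> K"
    "x \<in> K \<Longrightarrow> - x \<in> K" "x \<in> K \<Longrightarrow> inverse x \<in> K" "x \<in> K \<Longrightarrow> y \<in> K \<Longrightarrow> x - y \<in> K"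
    "x \<in> K \<Longrightarrow> x ^ n \<in> K"
proof -
  note K = assms[unfolded is_division_subring_def]
  show "0 \<in> K" "1 \<in> K" "x \<in> K \<Longrightarrow> y \<in> K \<Longrightarrow> x + y \<in> K" "x \<in> K \<Longrightarrow> y \<in> K \<Longrightarrow> x * y \<in> K"
    "x \<in> K \<Longrightarrow> - x \<in> K"
    using K by auto
  show "x \<in> K \<Longrightarrow> inverse x \<in> K"
    using K by (cases "x = 0") auto
  show "x \<in> K \<Longrightarrow> y \<in> K \<Longrightarrow> x - y \<in> K"
    using K by (metis diff_conv_add_uminus)
  show "x \<in> K \<Longrightarrow> x ^ n \<in> K"
    using K by (induction n) auto
qed

lemma division_subring_sum:
  assumes "is_division_subring K" "\<And>i. i \<in> I \<Longrightarrow> f i \<in> K"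
  shows "sum f I \<in> K"
  using assms(2) by (induction I rule: infinite_finite_induct) (auto simp: division_subringD[OF assms(1)])

lemma inverse_commute:
  fixes x y :: "'a::division_ring"
  assumes "x * y = y * x"
  shows "inverse x * y = y * inverse x"
proof (cases "x = 0")
  case False
  have "inverse x * y = inverse x * (y * x) * inverse x"
    using False by (simp add: mult.assoc)
  also have "\<dots> = y * inverse x"
    using False by (simp add: assms[symmetric] mult.assoc[symmetric])
  finally show ?thesis .
qed simp

lemma inverse_mult_cancel_left:
  fixes a y :: "'a::division_ring"
  assumes "a \<noteq> 0"
  shows "inverse a * (a * y) = y" "a * (inverse a * y) = y"
  using assms by (simp_all flip: mult.assoc)

text \<open>Stated for an arbitrary set \<open>X\<close> so that one proof serves several purposes:
  \<open>X = K\<close> gives the relative center, a singleton gives the centralizer of one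
  element.\<close>

lemma division_subring_centralizer:
  assumes "is_division_subring K"
  shows "is_division_subring {z \<in> K. \<forall>x\<in>X. z * x = x * z}"
proof -
  have "(z * w) * x = x * (z * w)" if "z * x = x * z" "w * x = x * w" for z w x :: 'a
    using that by (metis mult.assoc)
  then show ?thesis
    unfolding is_division_subring_def
    by (auto simp: division_subringD[OF assms] distrib_left distrib_right inverse_commute)
qed

lemma rel_center_subset: "rel_center K \<subseteq> K"
  by (auto simp: rel_center_def)

lemma rel_center_commute: "z \<in> rel_center K \<Longrightarrow> x \<in> K \<Longrightarrow> z * x = x * z"
  by (auto simp: rel_center_def)

lemma division_subring_rel_center:
  "is_division_subring K \<Longrightarrow> is_division_subring (rel_center K)"
  unfolding rel_center_def by (rule division_subring_centralizer)

text \<open>A spanning set of least cardinality is independent: in a nontrivial relation, an element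
  with nonzero coefficient could be expressed through the others and dropped.\<close>

lemma finite_basis_over_center:
  assumes K: "is_division_subring K" and fd: "fin_dim_over_center K"
  obtains B where "finite B" "B \<subseteq> K" "B \<noteq> {}"
    "\<forall>x\<in>K. \<exists>c. (\<forall>b\<in>B. c b \<in> rel_center K) \<and> x = (\<Sum>b\<in>B. c b * b)"
    "\<forall>c. (\<forall>b\<in>B. c b \<in> rel_center K) \<longrightarrow> (\<Sum>b\<in>B. c b * b) = 0 \<longrightarrow> (\<forall>b\<in>B. c b = 0)"
proof -
  define spanning where "spanning B \<longleftrightarrow> finite B \<and> B \<subseteq> K \<and>
     (\<forall>x\<in>K. \<exists>c. (\<forall>b\<in>B. c b \<in> rel_center K) \<and> x = (\<Sum>b\<in>B. c b * b))" for B
  have "\<exists>B. spanning B"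
    using fd by (auto simp: fin_dim_over_center_def spanning_def)
  then obtain B where B: "spanning B" and min: "\<And>B'. spanning B' \<Longrightarrow> card B \<le> card B'"
    using ex_has_least_nat[of spanning _ card] by metis
  note Z = division_subringD[OF division_subring_rel_center[OF K]]
  have fin: "finite B" and BK: "B \<subseteq> K"
    and span: "\<And>x. x \<in> K \<Longrightarrow> \<exists>c. (\<forall>b\<in>B. c b \<in> rel_center K) \<and> x = (\<Sum>b\<in>B. c b * b)"
    using B by (auto simp: spanning_def)
  have ne: "B \<noteq> {}"
    using span[OF division_subringD(2)[OF K]] by auto
  have indep: "c k = 0" if c: "\<And>b. b \<in> B \<Longrightarrow> c b \<in> rel_center K"
    and 0: "(\<Sum>b\<in>B. c b * b) = 0" and k: "k \<in> B" for c k
  proof (rule ccontr)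
    assume ck: "c k \<noteq> 0"
    have "spanning (B - {k})"
      unfolding spanning_def
    proof (intro conjI ballI)
      fix x assume "x \<in> K"
      then obtain d where d: "\<And>b. b \<in> B \<Longrightarrow> d b \<in> rel_center K" and x: "x = (\<Sum>b\<in>B. d b * b)"
        using span by blast
      \<comment> \<open>Solve the relation for \<open>k\<close> and scale it by
        \<open>d k * inverse (c k)\<close>; substituting then removes \<open>k\<close> from the
        expansion of \<open>x\<close>.\<close>
      have "c k * k = - (\<Sum>b\<in>B-{k}. c b * b)"
        using 0 by (simp add: sum.remove[OF fin k] eq_neg_iff_add_eq_0)
      then have "d k * inverse (c k) * (c k * k) = - (\<Sum>b\<in>B-{k}. d k * inverse (c k) * c b * b)"
        by (simp add: sum_distrib_left mult.assoc)
      then have "d k * k = - (\<Sum>b\<in>B-{k}. d k * inverse (c k) * c b * b)"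
        using ck by (metis (no_types, lifting) mult.assoc left_inverse mult.right_neutral)
      then have "x = (\<Sum>b\<in>B-{k}. (d b - d k * inverse (c k) * c b) * b)"
        by (simp add: x sum.remove[OF fin k] left_diff_distrib sum_subtractf)
      moreover have "\<forall>b\<in>B-{k}. d b - d k * inverse (c k) * c b \<in> rel_center K"
        using c d k by (auto intro!: Z)
      ultimately show "\<exists>c. (\<forall>b\<in>B-{k}. c b \<in> rel_center K) \<and> x = (\<Sum>b\<in>B-{k}. c b * b)"
        by (intro exI conjI)
    qed (use fin BK in auto)
    from min[OF this] show False
      using k fin by (metis card_Diff1_less not_le)
  qed
  show thesis
    using span indep by (intro that[OF fin BK ne]) blast+
qed

section \<open>The norm over the center\<close>

text \<open>Records the three properties of the determinant norm that are used later, free of any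
  basis. In the construction, \<open>N\<close> is the dimension over the center.\<close>

definition has_norm :: "'a::division_ring set \<Rightarrow> bool" where
  "has_norm K \<longleftrightarrow> (\<exists>N>0. \<exists>\<nu>. (\<forall>x\<in>K. \<forall>y\<in>K. \<nu> (x * y) = \<nu> x * \<nu> y) \<and>
     (\<forall>x\<in>K. \<nu> x \<in> rel_center K) \<and> (\<forall>z\<in>rel_center K. \<nu> z = z ^ N))"

text \<open>
  Determinants need a type of scalars, but the center of \<open>K\<close> depends on the variable \<open>K\<close>. So the type
  is defined for a single choice of \<open>K\<close>: a counterexample to the existence of a norm, if there is one
  (and the whole ring otherwise). Constructing its norm then shows that there is no counterexample.
\<close>

definition normless :: "'a::division_ring set" where
  "normless = (if \<exists>K::'a set. is_division_subring K \<and> fin_dim_over_center K \<and> \<not> has_norm K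
     then SOME K. is_division_subring K \<and> fin_dim_over_center K \<and> \<not> has_norm K else UNIV)"

lemma normless:
  "is_division_subring K \<Longrightarrow> fin_dim_over_center K \<Longrightarrow> \<not> has_norm (K :: 'a::division_ring set) \<Longrightarrow>
   fin_dim_over_center (normless :: 'a set) \<and> \<not> has_norm (normless :: 'a set)"
  unfolding normless_def
  by (smt (verit, best) someI_ex)

text \<open>Covers both branches of the choice, so that the center of \<open>normless\<close> can
  become a type unconditionally.\<close>

lemma division_subring_normless: "is_division_subring normless"
proof (cases "\<exists>K::'a set. is_division_subring K \<and> fin_dim_over_center K \<and> \<not> has_norm K")
  case True
  from someI_ex[OF this] show ?thesis
    by (simp only: normless_def True if_True)
next
  case False
  then show ?thesis
    by (simp only: normless_def if_False) (simp add: is_division_subring_def)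
qed

lemmas normless_center = division_subringD[OF division_subring_rel_center[OF division_subring_normless]]

typedef (overloaded) 'a normless_center = "rel_center (normless :: 'a::division_ring set)"
  morphisms scalar to_center
  using normless_center(1) by blast

setup_lifting type_definition_normless_center

instantiation normless_center :: (division_ring) comm_ring_1
begin

lift_definition zero_normless_center :: "'a normless_center" is 0 by (rule normless_center)
lift_definition one_normless_center :: "'a normless_center" is 1 by (rule normless_center)
lift_definition plus_normless_center :: "'a normless_center \<Rightarrow> 'a normless_center \<Rightarrow> 'a normless_center"
  is "(+)" by (rule normless_center)
lift_definition times_normless_center :: "'a normless_center \<Rightarrow> 'a normless_center \<Rightarrow> 'a normless_center"
  is "(*)" by (rule normless_center)
lift_definition minus_normless_center :: "'a normless_center \<Rightarrow> 'a normless_center \<Rightarrow> 'a normless_center"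
  is "(-)" by (rule normless_center)
lift_definition uminus_normless_center :: "'a normless_center \<Rightarrow> 'a normless_center"
  is uminus by (rule normless_center)

instance
proof
  fix a b c :: "'a normless_center"
  show "a * b = b * a"
    by transfer (metis rel_center_commute rel_center_subset subsetD)
qed (transfer; simp add: algebra_simps)+

end

lemma scalar_sum: "scalar (sum f A) = (\<Sum>i\<in>A. scalar (f i))"
  by (induction A rule: infinite_finite_induct)
    (auto simp: zero_normless_center.rep_eq plus_normless_center.rep_eq)

lemma scalar_power: "scalar (z ^ n) = scalar z ^ n"
  by (induction n) (auto simp: one_normless_center.rep_eq times_normless_center.rep_eq)

text \<open>Left multiplication by \<open>x\<close> is linear over the center, hence given by a
  matrix \<open>\<rho> x\<close> with central entries. The determinant of \<open>\<rho> x\<close> is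
  multiplicative in \<open>x\<close>, and a central \<open>z\<close> acts as \<open>z\<close> times
  the identity, with determinant \<open>z ^ N\<close>.\<close>

lemma normless_has_norm:
  assumes fd: "fin_dim_over_center (normless :: 'a::division_ring set)"
  shows "has_norm (normless :: 'a set)"
proof -
  define K where "K = (normless :: 'a set)"
  note K = division_subring_normless[where 'a='a, folded K_def]
  obtain B where fin: "finite B" and BK: "B \<subseteq> K" and ne: "B \<noteq> {}"
    and span: "\<forall>x\<in>K. \<exists>c. (\<forall>b\<in>B. c b \<in> rel_center K) \<and> x = (\<Sum>b\<in>B. c b * b)"
    and indep: "\<forall>c. (\<forall>b\<in>B. c b \<in> rel_center K) \<longrightarrow> (\<Sum>b\<in>B. c b * b) = 0 \<longrightarrow> (\<forall>b\<in>B. c b = 0)"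
    by (rule finite_basis_over_center[OF K fd[folded K_def]])
  define N where "N = card B"
  have N: "N > 0"
    using fin ne by (simp add: N_def card_gt_0_iff)
  obtain e where e: "bij_betw e {0..<N} B"
    unfolding N_def using ex_bij_betw_nat_finite[OF fin] by blast
  have eK: "i < N \<Longrightarrow> e i \<in> K" for i
    using e BK by (auto simp: bij_betw_def)
  have scal: "scalar z \<in> rel_center K" for z
    unfolding K_def by (rule scalar)
  have ind: "c i = 0" if "(\<Sum>i=0..<N. scalar (c i) * e i) = 0" "i < N" for c i
  proof -
    define e' where "e' = the_inv_into {0..<N} e"
    have e': "i < N \<Longrightarrow> e' (e i) = i" for i
      unfolding e'_def using e by (auto simp: bij_betw_def the_inv_into_f_f)
    have "(\<Sum>b\<in>B. scalar (c (e' b)) * b) = (\<Sum>i=0..<N. scalar (c (e' (e i))) * e i)"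
      by (rule sum.reindex_bij_betw[OF e, symmetric])
    also have "\<dots> = 0"
      using that by (simp add: e')
    finally have "scalar (c (e' (e i))) = 0"
      using that e scal by (intro indep[rule_format, of "\<lambda>b. scalar (c (e' b))"]) (auto simp: bij_betw_def)
    then show ?thesis
      using that by (simp add: e' zero_normless_center.rep_eq[symmetric] scalar_inject)
  qed
  have "\<exists>c. x = (\<Sum>i=0..<N. scalar (c i) * e i)" if x: "x \<in> K" for x
  proof -
    obtain c where c: "\<And>b. b \<in> B \<Longrightarrow> c b \<in> rel_center K" "x = (\<Sum>b\<in>B. c b * b)"
      using bspec[OF span x] by blast
    have "x = (\<Sum>i=0..<N. c (e i) * e i)"
      unfolding c(2) by (rule sum.reindex_bij_betw[OF e, symmetric])
    also have "\<dots> = (\<Sum>i=0..<N. scalar (to_center (c (e i))) * e i)"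
      using c(1) e by (intro sum.cong) (auto simp: to_center_inverse bij_betw_def K_def)
    finally show ?thesis by (intro exI[of _ "\<lambda>i. to_center (c (e i))"])
  qed
  then have "\<exists>coord. \<forall>x\<in>K. x = (\<Sum>i=0..<N. scalar (coord x i) * e i)"
    by (intro bchoice ballI)
  then obtain coord where coord: "\<And>x. x \<in> K \<Longrightarrow> x = (\<Sum>i=0..<N. scalar (coord x i) * e i)"
    by blast
  have coord_unique: "coord x i = c i"
    if x: "x \<in> K" "x = (\<Sum>i=0..<N. scalar (c i) * e i)" and i: "i < N" for x c i
  proof -
    have "(\<Sum>i=0..<N. scalar (coord x i - c i) * e i) = 0"
      using x(2)[symmetric] by (simp add: minus_normless_center.rep_eq left_diff_distrib sum_subtractf coord[OF x(1), symmetric])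
    from ind[OF this i] show ?thesis by simp
  qed
  \<comment> \<open>Column \<open>j\<close> lists the coordinates of \<open>x * e j\<close>. Scalars
    also stand on the left, but they commute with \<open>x\<close>, which is why the products of
    matrices come out right below.\<close>
  define \<rho> where "\<rho> x = mat N N (\<lambda>(i, j). coord (x * e j) i)" for x
  have \<rho>: "\<rho> x \<in> carrier_mat N N" for x
    by (simp add: \<rho>_def)
  have mult: "\<rho> (x * y) = \<rho> x * \<rho> y" if x: "x \<in> K" and y: "y \<in> K" for x y
  proof (rule eq_matI)
    fix i j assume "i < dim_row (\<rho> x * \<rho> y)" "j < dim_col (\<rho> x * \<rho> y)"
    then have i: "i < N" and j: "j < N" by (auto simp: \<rho>_def)
    have "x * y * e j = x * (\<Sum>k=0..<N. scalar (coord (y * e j) k) * e k)"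
      using y eK[OF j] by (simp add: coord[symmetric] division_subringD(4)[OF K] mult.assoc)
    also have "\<dots> = (\<Sum>k=0..<N. scalar (coord (y * e j) k) * (x * e k))"
      unfolding sum_distrib_left
      by (intro sum.cong refl) (metis rel_center_commute[OF scal x] mult.assoc)
    also have "\<dots> = (\<Sum>k=0..<N. \<Sum>i=0..<N. scalar (coord (y * e j) k) * (scalar (coord (x * e k) i) * e i))"
      using x eK by (intro sum.cong refl)
        (simp add: coord[symmetric] division_subringD(4)[OF K] sum_distrib_left[symmetric])
    also have "\<dots> = (\<Sum>i=0..<N. \<Sum>k=0..<N. scalar (coord (y * e j) k) * (scalar (coord (x * e k) i) * e i))"
      by (rule sum.swap)
    also have "\<dots> = (\<Sum>i=0..<N. scalar (\<Sum>k=0..<N. coord (x * e k) i * coord (y * e j) k) * e i)"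
      by (simp add: scalar_sum sum_distrib_right mult.assoc[symmetric] flip: times_normless_center.rep_eq)
        (simp add: mult.commute)
    finally have eq: "x * y * e j = \<dots>" .
    have "x * y * e j \<in> K"
      by (intro division_subringD(4)[OF K] x y eK j)
    from coord_unique[OF this eq i]
    have "coord (x * y * e j) i = (\<Sum>k=0..<N. coord (x * e k) i * coord (y * e j) k)" .
    then show "\<rho> (x * y) $$ (i, j) = (\<rho> x * \<rho> y) $$ (i, j)"
      using i j by (simp add: \<rho>_def scalar_prod_def)
  qed (auto simp: \<rho>_def)
  have center: "\<rho> (scalar z) = z \<cdot>\<^sub>m 1\<^sub>m N" for z
  proof (rule eq_matI)
    fix i j assume "i < dim_row (z \<cdot>\<^sub>m 1\<^sub>m N)" "j < dim_col (z \<cdot>\<^sub>m 1\<^sub>m N)"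
    then have i: "i < N" and j: "j < N" by auto
    have eq: "scalar z * e j = (\<Sum>i=0..<N. scalar (if i = j then z else 0) * e i)"
      using j by (simp add: if_distrib[of scalar] if_distrib[of "\<lambda>x. x * _"] zero_normless_center.rep_eq
          sum.delta cong: if_cong)
    have "scalar z * e j \<in> K"
      using eK[OF j] scal[of z] rel_center_subset[of K] by (auto intro!: division_subringD[OF K])
    from coord_unique[OF this eq i]
    have "coord (scalar z * e j) i = (if i = j then z else 0)" .
    then show "\<rho> (scalar z) $$ (i, j) = (z \<cdot>\<^sub>m 1\<^sub>m N) $$ (i, j)"
      using i j by (simp add: \<rho>_def)
  qed (auto simp: \<rho>_def)
  have "has_norm K"
    unfolding has_norm_def
  proof (intro exI[of _ N] exI[of _ "\<lambda>x. scalar (det (\<rho> x))"] conjI ballI N)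
    fix x y assume "x \<in> K" "y \<in> K"
    then show "scalar (det (\<rho> (x * y))) = scalar (det (\<rho> x)) * scalar (det (\<rho> y))"
      by (simp add: mult det_mult[OF \<rho> \<rho>] times_normless_center.rep_eq)
  next
    fix z assume "z \<in> rel_center K"
    then obtain z' where "z = scalar z'"
      unfolding K_def by (metis to_center_inverse)
    then show "scalar (det (\<rho> z)) = z ^ N"
      by (simp add: center scalar_power)
  qed (rule scal)
  then show ?thesis by (simp add: K_def)
qed

text \<open>By the choice of \<open>normless\<close>, any counterexample would make
  \<open>normless\<close> one as well.\<close>

lemma norm_exists:
  assumes "is_division_subring K" "fin_dim_over_center K"
  shows "has_norm K"
  using normless[OF assms] normless_has_norm[where 'a='a] by blast

text \<open>The norm of a commutator \<open>c\<close> is \<open>1\<close> because norms lie in the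
  center and so commute. If \<open>c ^ n\<close> is central, its norm is both \<open>1\<close> and
  \<open>(c ^ n) ^ N\<close>, so \<open>c ^ (n * N) = 1\<close>.\<close>

lemma central_commutator_power_torsion:
  fixes a b :: "'a::division_ring"
  assumes K: "is_division_subring K" and fd: "fin_dim_over_center K"
    and ab: "a \<in> K" "b \<in> K" "a \<noteq> 0" "b \<noteq> 0"
    and n: "n > 0" "(a * b * inverse a * inverse b) ^ n \<in> rel_center K"
  shows "\<exists>m>0. (a * b * inverse a * inverse b) ^ m = 1"
proof -
  obtain N \<nu> where N: "N > 0" and mult: "\<And>x y. x \<in> K \<Longrightarrow> y \<in> K \<Longrightarrow> \<nu> (x * y) = \<nu> x * \<nu> y"
    and \<nu>Z: "\<And>x. x \<in> K \<Longrightarrow> \<nu> x \<in> rel_center K" and \<nu>: "\<And>z. z \<in> rel_center K \<Longrightarrow> \<nu> z = z ^ N"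
    using norm_exists[OF K fd] unfolding has_norm_def by metis
  note KD = division_subringD[OF K]
  have 1: "\<nu> 1 = 1"
    using \<nu>[OF division_subringD(2)[OF division_subring_rel_center[OF K]]] by simp
  have comm: "\<nu> x * \<nu> y = \<nu> y * \<nu> x" if "x \<in> K" "y \<in> K" for x y
    using \<nu>Z that rel_center_subset by (metis rel_center_commute subsetD)
  have inv: "\<nu> x * \<nu> (inverse x) = 1" if "x \<in> K" "x \<noteq> 0" for x
    using mult[OF that(1) KD(6)[OF that(1)]] that 1 by simp
  define c where "c = a * b * inverse a * inverse b"
  have cK: "c \<in> K"
    unfolding c_def by (intro KD ab)
  have "\<nu> c = \<nu> a * \<nu> b * \<nu> (inverse a) * \<nu> (inverse b)"
    unfolding c_def using ab by (simp add: mult KD)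
  also have "\<dots> = \<nu> b * (\<nu> a * \<nu> (inverse a)) * \<nu> (inverse b)"
    using comm[OF ab(1,2)] by (simp add: mult.assoc)
  also have "\<dots> = 1"
    using inv ab by simp
  finally have c1: "\<nu> c = 1" .
  have "\<nu> (c ^ k) = 1" for k
    using cK by (induction k) (auto simp: 1 mult KD c1)
  then have "(c ^ n) ^ N = 1"
    using \<nu>[OF n(2)] c_def by metis
  then show ?thesis
    using N n(1) by (intro exI[of _ "n * N"]) (auto simp: c_def power_mult)
qed

section \<open>Wedderburn's little theorem\<close>

lemma prod_mset_gt:
  fixes c :: real
  assumes "c \<ge> 1" "A \<noteq> {#}" "\<And>x. x \<in># A \<Longrightarrow> f x > c"
  shows "prod_mset (image_mset f A) > c"
  using assms(2,3)
proof (induction A)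
  case (add x A)
  show ?case
  proof (cases "A = {#}")
    case False
    then have "prod_mset (image_mset f A) > c" "f x > c"
      using add by auto
    then have "c * c < f x * prod_mset (image_mset f A)"
      using assms(1) by (intro mult_strict_mono) auto
    moreover have "c * 1 \<le> c * c"
      using assms(1) by (intro mult_left_mono) auto
    ultimately show ?thesis by simp
  qed (use add in auto)
qed simp

text \<open>On the unit circle, \<open>1\<close> is the only point nearest to \<open>q\<close>:
  \<open>Re a < 1\<close> makes the squared distance \<open>q^2 - 2 q Re a + 1\<close> larger than
  \<open>(q - 1)^2\<close>.\<close>

lemma norm_of_nat_minus_root_of_unity:
  fixes a :: complex
  assumes "norm a = 1" "a \<noteq> 1" "q > 0"
  shows "norm (of_nat q - a) > real q - 1"
proof -
  have a: "(Re a)\<^sup>2 + (Im a)\<^sup>2 = 1"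
    using assms(1) by (simp add: cmod_def)
  have "Re a < 1"
  proof (rule ccontr)
    assume "\<not> Re a < 1"
    moreover have "Re a \<le> 1"
      using complex_Re_le_cmod[of a] assms(1) by simp
    ultimately have "Re a = 1" by simp
    with a have "a = 1" by (simp add: complex_eq_iff)
    with assms(2) show False ..
  qed
  then have "real q * Re a < real q * 1"
    using assms(3) by (intro mult_strict_left_mono) auto
  then have "(real q - 1)\<^sup>2 < (real q - Re a)\<^sup>2 + (Im a)\<^sup>2"
    using a by (simp add: power2_diff)
  also have "\<dots> = (norm (of_nat q - a))\<^sup>2"
    by (simp add: cmod_def)
  finally show ?thesis
    using norm_ge_zero power2_less_imp_less by blast
qed

text \<open>\<open>\<Phi>\<close> is, up to sign, the value at \<open>q\<close> of the
  \<open>n\<close>-th cyclotomic polynomial. Each \<open>x^d - 1\<close> divides the lcm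
  \<open>R\<close>, which gives the factorizations. The bound comes from the linear factors of
  \<open>P\<close>: there is at least one root, all roots are \<open>n\<close>-th roots of unity
  other than \<open>1\<close>, and the leading coefficient is \<open>1\<close> or
  \<open>-1\<close>.\<close>

lemma ex_cyclotomic_value:
  assumes q: "q \<ge> (2::nat)" and n: "n \<ge> 2"
  obtains \<Phi> :: int where "\<bar>\<Phi>\<bar> > int q - 1"
    "\<And>d. d dvd n \<Longrightarrow> d < n \<Longrightarrow> \<exists>s. int q ^ n - 1 = (int q ^ d - 1) * s * \<Phi>"
proof -
  define p where "p d = (monom 1 d - 1 :: int poly)" for d
  define D where "D = {d. d dvd n \<and> d < n}"
  have fin: "finite D" by (simp add: D_def)
  have p_dvd: "p d dvd p n" if d: "d \<in> D" for d
  proof -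
    obtain k where "n = d * k" using d by (auto simp: D_def)
    then have "p n = (monom 1 d) ^ k - 1" by (simp add: p_def monom_power mult.commute)
    then show ?thesis by (simp add: power_diff_1_eq p_def)
  qed
  \<comment> \<open>The cofactor \<open>P\<close> of the least common multiple is the \<open>n\<close>-th cyclotomic polynomial up to sign.\<close>
  define R where "R = Lcm\<^sub>f\<^sub>i\<^sub>n (p ` D)"
  have R: "p d dvd R" if "d \<in> D" for d
    unfolding R_def using that by (intro dvd_Lcm_fin) auto
  have "R dvd p n"
    unfolding R_def by (rule Lcm_fin_least) (use fin p_dvd in auto)
  then obtain P where P: "p n = R * P" by (elim dvdE)
  \<comment> \<open>The product is a convenient multiple of \<open>R\<close>: it does not vanish at
    a primitive \<open>n\<close>-th root of unity, hence neither does \<open>R\<close>, so that root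
    must be a root of \<open>P\<close>.\<close>
  have "R dvd prod p D"
    unfolding R_def by (rule Lcm_fin_least) (use fin in auto)
  then obtain S where S: "prod p D = R * S" by (elim dvdE)
  let ?c = "map_poly of_int :: int poly \<Rightarrow> complex poly"
  have cp: "?c (p d) = monom 1 d - 1" for d
    by (simp add: p_def hom_distribs)
  have cR: "poly (?c (p n)) z = poly (?c R) z * poly (?c P) z" for z
    by (simp add: P hom_distribs)
  define \<omega> where "\<omega> = cis (2 * pi / real n)"
  have \<omega>n: "\<omega> ^ n = 1"
    using n by (simp add: \<omega>_def Complex.DeMoivre)
  have \<omega>d: "\<omega> ^ d \<noteq> 1" if d: "d \<in> D" for d
  proof
    assume "\<omega> ^ d = 1"
    then have "cos (2 * pi * (real d / real n)) = 1"
      by (simp add: \<omega>_def Complex.DeMoivre complex_eq_iff mult.commute)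
    then obtain k :: int where "2 * pi * (real d / real n) = of_int k * 2 * pi"
      unfolding cos_one_2pi_int by blast
    then have "real d = of_int k * real n"
      using n by (simp add: field_simps)
    then have "real_of_int (int d) = real_of_int (k * int n)"
      by simp
    then have "int d = k * int n"
      by linarith
    then have "n dvd d"
      by (metis dvd_triv_right int_dvd_int_iff)
    with d n show False
      by (auto simp: D_def dest: dvd_imp_le dest!: dvd_antisym)
  qed
  have "poly (?c (prod p D)) \<omega> = (\<Prod>d\<in>D. \<omega> ^ d - 1)"
    by (simp add: hom_distribs poly_prod poly_monom p_def)
  also have "\<dots> \<noteq> 0"
    using fin \<omega>d by auto
  finally have "poly (?c R) \<omega> \<noteq> 0"
    by (auto simp: S hom_distribs)
  then have P\<omega>: "poly (?c P) \<omega> = 0"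
    using cR[of \<omega>] \<omega>n by (auto simp: cp poly_monom)
  \<comment> \<open>\<open>R\<close> vanishes at \<open>1\<close> through its factor
    \<open>p 1\<close>. If \<open>P\<close> did too, \<open>1\<close> would be a double root of
    \<open>x^n - 1\<close>, whose derivative there is \<open>n\<close>.\<close>
  have P1: "poly (?c P) 1 \<noteq> 0"
  proof
    assume P1: "poly (?c P) 1 = 0"
    have "1 \<in> D" using n by (auto simp: D_def)
    from R[OF this] obtain T where "R = p 1 * T" by (elim dvdE)
    then have R1: "poly (?c R) 1 = 0"
      by (simp add: hom_distribs p_def poly_monom)
    have "monom 1 n - 1 = ?c R * ?c P"
      unfolding cp[symmetric] P by (simp add: hom_distribs)
    then have "poly (pderiv (monom 1 n - 1)) (1::complex) = poly (pderiv (?c R * ?c P)) 1"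
      by simp
    then show False
      using n P1 R1 by (simp add: pderiv_mult pderiv_diff pderiv_monom poly_monom)
  qed
  have "lead_coeff (- 1 + monom 1 n :: int poly) = lead_coeff (monom 1 n)"
    by (rule lead_coeff_add_le) (use n in \<open>simp add: degree_monom_eq\<close>)
  then have "lead_coeff (p n) = 1"
    by (simp add: p_def degree_monom_eq)
  then have "lead_coeff R * lead_coeff P = 1"
    by (simp add: P lead_coeff_mult)
  then have "\<bar>lead_coeff P\<bar> = 1"
    by (auto simp: zmult_eq_1_iff)
  moreover have "lead_coeff (?c P) = of_int (lead_coeff P)"
    by simp
  ultimately have lc: "norm (lead_coeff (?c P)) = 1"
    by (simp only: norm_of_int)
  then have "?c P \<noteq> 0" by auto
  then obtain A where A: "?c P = Polynomial.smult (lead_coeff (?c P)) (\<Prod>x\<in>#A. [:-x, 1:])"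
    using alg_closed_imp_factorization by blast
  have polyA: "poly (?c P) z = lead_coeff (?c P) * (\<Prod>x\<in>#A. z - x)" for z
    by (subst A) (simp add: poly_prod_mset image_mset.compositionality o_def)
  have "A \<noteq> {#}"
    using polyA[of \<omega>] P\<omega> lc by auto
  moreover have "norm (of_nat q - a) > real q - 1" if a: "a \<in># A" for a
  proof (rule norm_of_nat_minus_root_of_unity)
    have "poly (?c P) a = 0"
      using polyA[of a] a by (auto simp: prod_mset_zero_iff)
    then have "a ^ n = 1" and "a \<noteq> 1"
      using cR[of a] P1 by (auto simp: cp poly_monom)
    then show "a \<noteq> 1" "norm a = 1"
      using n by (auto dest: power_eq_1_iff)
  qed (use q in auto)
  ultimately have "(\<Prod>x\<in>#A. norm (of_nat q - x)) > real q - 1"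
    using q by (intro prod_mset_gt) auto
  also have "(\<Prod>x\<in>#A. norm (of_nat q - x)) = norm (poly (?c P) (of_int (int q)))"
    unfolding polyA norm_mult lc by (induction A) (auto simp: norm_mult)
  also have "\<dots> = real_of_int \<bar>poly P (int q)\<bar>"
    by (simp only: of_int_hom.poly_map_poly norm_of_int)
  finally have "\<bar>poly P (int q)\<bar> > int q - 1"
    by linarith
  moreover have "\<exists>s. int q ^ n - 1 = (int q ^ d - 1) * s * poly P (int q)" if "d dvd n" "d < n" for d
  proof -
    have "p d dvd R"
      using that by (intro R) (simp add: D_def)
    then obtain s where "R = p d * s" by (elim dvdE)
    then have "poly (p n) (int q) = poly (p d) (int q) * poly s (int q) * poly P (int q)"
      by (simp add: P)
    then show ?thesis
      by (auto simp: p_def poly_monom)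
  qed
  ultimately show thesis
    by (rule that)
qed

text \<open>\<open>A\<close> is a left vector space over \<open>M\<close>. A subspace
  \<open>W\<close> is enlarged by one vector \<open>x\<close> at a time; \<open>W + M x\<close> has
  \<open>card W * card M\<close> elements because \<open>x\<close> lies outside
  \<open>W\<close>.\<close>

lemma card_eq_power_of_scalars:
  fixes A M :: "'a::division_ring set"
  assumes M: "is_division_subring M" and fin: "finite A" and A0: "0 \<in> A"
    and add: "\<And>x y. x \<in> A \<Longrightarrow> y \<in> A \<Longrightarrow> x + y \<in> A"
    and scale: "\<And>m x. m \<in> M \<Longrightarrow> x \<in> A \<Longrightarrow> m * x \<in> A"
  shows "\<exists>k. card A = card M ^ k"
proof -
  note MD = division_subringD[OF M]
  define sub where "sub W \<longleftrightarrow> 0 \<in> W \<and> W \<subseteq> A \<and> (\<forall>x\<in>W. \<forall>y\<in>W. x + y \<in> W) \<and> (\<forall>m\<in>M. \<forall>x\<in>W. m * x \<in> W)" for W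
  have "\<exists>k. card A = card M ^ k" if "sub W" "card W = card M ^ i" for W i
    using that
  proof (induction "card A - card W" arbitrary: W i rule: less_induct)
    case less
    show ?case
    proof (cases "W = A")
      case True
      then show ?thesis using less.prems by blast
    next
      case False
      then obtain x where x: "x \<in> A" "x \<notin> W"
        using less.prems by (auto simp: sub_def)
      have W: "0 \<in> W" "W \<subseteq> A" "\<And>x y. x \<in> W \<Longrightarrow> y \<in> W \<Longrightarrow> x + y \<in> W"
        "\<And>m x. m \<in> M \<Longrightarrow> x \<in> W \<Longrightarrow> m * x \<in> W"
        using less.prems by (auto simp: sub_def)
      have W': "w - w' \<in> W" if "w \<in> W" "w' \<in> W" for w w'
        using W(3)[OF that(1) W(4)[OF MD(5)[OF MD(2)] that(2)]] by simp
      define f where "f = (\<lambda>(w, m). w + m * x)"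
      have inj: "inj_on f (W \<times> M)"
      proof (rule inj_onI, clarsimp simp: f_def)
        fix w m w' m'
        assume *: "w \<in> W" "m \<in> M" "w' \<in> W" "m' \<in> M" "w + m * x = w' + m' * x"
        then have eq: "(m - m') * x = w' - w"
          by (simp add: algebra_simps)
        have "m = m'"
        proof (rule ccontr)
          assume "m \<noteq> m'"
          then have "x = inverse (m - m') * (w' - w)"
            by (simp add: eq[symmetric] mult.assoc[symmetric])
          moreover have "\<dots> \<in> W"
            using * by (intro W(4) W' MD)
          ultimately show False using x by simp
        qed
        with * show "w = w' \<and> m = m'" by simp
      qed
      have sub: "sub (f ` (W \<times> M))"
        unfolding sub_def
      proof (intro conjI ballI)
        show "0 \<in> f ` (W \<times> M)"
          using W(1) MD(1) by (force simp: f_def)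
        show "f ` (W \<times> M) \<subseteq> A"
          using W(2) x(1) by (auto simp: f_def intro!: add scale)
      next
        fix y z assume "y \<in> f ` (W \<times> M)" "z \<in> f ` (W \<times> M)"
        then obtain w m w' m' where "w \<in> W" "m \<in> M" "w' \<in> W" "m' \<in> M"
          "y = w + m * x" "z = w' + m' * x"
          by (auto simp: f_def)
        then have "y + z = f (w + w', m + m')" "(w + w', m + m') \<in> W \<times> M"
          by (auto simp: f_def algebra_simps W MD)
        then show "y + z \<in> f ` (W \<times> M)" by blast
      next
        fix l y assume "l \<in> M" "y \<in> f ` (W \<times> M)"
        then obtain w m where "w \<in> W" "m \<in> M" "y = w + m * x"
          by (auto simp: f_def)
        then have "l * y = f (l * w, l * m)" "(l * w, l * m) \<in> W \<times> M"
          using \<open>l \<in> M\<close> by (auto simp: f_def algebra_simps W MD)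
        then show "l * y \<in> f ` (W \<times> M)" by blast
      qed
      have "W \<subset> f ` (W \<times> M)"
      proof
        show "W \<subseteq> f ` (W \<times> M)"
          using MD(1) by (force simp: f_def)
        have "x = f (0, 1)" by (simp add: f_def)
        then show "W \<noteq> f ` (W \<times> M)"
          using x(2) W(1) MD(2) by blast
      qed
      moreover have "f ` (W \<times> M) \<subseteq> A" using sub by (simp add: sub_def)
      ultimately have "card W < card (f ` (W \<times> M))" "card (f ` (W \<times> M)) \<le> card A"
        using fin by (meson psubset_card_mono card_mono finite_subset)+
      moreover have "card (f ` (W \<times> M)) = card M ^ Suc i"
        by (simp add: card_image[OF inj] card_cartesian_product less.prems)
      ultimately show ?thesis
        by (intro less.hyps[OF _ sub, of "Suc i"]) linarith+
    qed
  qed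
  from this[of "{0}" 0] show ?thesis
    using A0 by (simp add: sub_def)
qed

text \<open>Orbit-stabilizer count: the elements that conjugate \<open>x\<close> to
  \<open>b * x * inverse b\<close> form the coset of \<open>b\<close> by the nonzero part of the
  centralizer of \<open>x\<close>.\<close>

lemma card_conjugacy_class:
  fixes x :: "'a::division_ring"
  assumes A: "is_division_subring A" and fin: "finite A" and x: "x \<in> A"
  shows "card ((\<lambda>a. a * x * inverse a) ` (A - {0})) * (card {z \<in> A. z * x = x * z} - 1) = card A - 1"
proof -
  define G where "G = A - {0}"
  define C where "C = {z \<in> A. z * x = x * z}"
  note AD = division_subringD[OF A]
  have finG: "finite G" using fin by (simp add: G_def)
  have fiber: "card {a \<in> G. a * x * inverse a = b * x * inverse b} = card C - 1" if b: "b \<in> G" for b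
  proof -
    have "{a \<in> G. a * x * inverse a = b * x * inverse b} = (\<lambda>c. b * c) ` (C - {0})"
    proof (intro equalityI subsetI)
      fix a assume "a \<in> {a \<in> G. a * x * inverse a = b * x * inverse b}"
      then have a: "a \<in> G" and eq: "a * x * inverse a = b * x * inverse b" by auto
      have "inverse b * a * x = inverse b * (a * x * inverse a) * a"
        using a by (simp add: G_def mult.assoc)
      also have "\<dots> = x * (inverse b * a)"
        using b unfolding eq by (simp add: G_def mult.assoc[symmetric])
      finally have "inverse b * a \<in> C - {0}"
        using a b by (auto simp: G_def C_def mult.assoc intro!: AD)
      moreover have "a = b * (inverse b * a)"
        using b by (simp add: G_def mult.assoc[symmetric])
      ultimately show "a \<in> (\<lambda>c. b * c) ` (C - {0})" by blast
    next
      fix a assume "a \<in> (\<lambda>c. b * c) ` (C - {0})"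
      then obtain c where c: "c \<in> A" "c \<noteq> 0" "c * x = x * c" "a = b * c"
        by (auto simp: C_def)
      have "b * c * x * inverse (b * c) = b * (c * x) * inverse c * inverse b"
        using c b by (simp only: nonzero_inverse_mult_distrib mult.assoc G_def) (simp add: nonzero_inverse_mult_distrib mult.assoc)
      also have "\<dots> = b * x * inverse b"
        using c by (simp add: mult.assoc inverse_mult_cancel_left)
      finally show "a \<in> {a \<in> G. a * x * inverse a = b * x * inverse b}"
        using c b by (auto simp: G_def intro!: AD)
    qed
    also have "card \<dots> = card (C - {0})"
      using b by (intro card_image inj_onI) (simp add: G_def)
    also have "\<dots> = card C - 1"
      using AD(1) by (subst card_Diff_singleton) (auto simp: C_def)
    finally show ?thesis .
  qed
  have "card A - 1 = card G"
    unfolding G_def using AD(1) by (subst card_Diff_singleton) auto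
  also have "\<dots> = (\<Sum>y\<in>(\<lambda>a. a * x * inverse a) ` G. card {a \<in> G. a * x * inverse a = y})"
    using sum.image_gen[OF finG, of "\<lambda>_. 1::nat" "\<lambda>a. a * x * inverse a"] by simp
  also have "\<dots> = (\<Sum>y\<in>(\<lambda>a. a * x * inverse a) ` G. card C - 1)"
    using fiber by (intro sum.cong refl) auto
  finally show ?thesis
    by (simp add: G_def C_def)
qed

text \<open>Witt's proof. In the class equation, \<open>\<Phi>\<close> divides
  \<open>q^n - 1\<close> and the size of every noncentral conjugacy class, hence
  \<open>q - 1\<close>, although its absolute value is larger.\<close>

lemma wedderburn_little:
  assumes A: "is_division_subring A" and fin: "finite (A :: 'a::division_ring set)"
    and xy: "x \<in> A" "y \<in> A"
  shows "x * y = y * x"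
proof (rule ccontr)
  assume nc: "x * y \<noteq> y * x"
  note AD = division_subringD[OF A]
  define Z where "Z = rel_center A"
  have Z: "is_division_subring Z" "Z \<subseteq> A"
    by (auto simp: Z_def division_subring_rel_center[OF A] rel_center_subset[THEN subsetD])
  have finZ: "finite Z" using Z(2) fin by (rule finite_subset)
  define q where "q = card Z"
  have two: "card S \<ge> 2" if "is_division_subring S" "finite S" for S :: "'a set"
  proof -
    have "{0, 1} \<subseteq> S" using division_subringD[OF that(1)] by auto
    from card_mono[OF that(2) this] show ?thesis by simp
  qed
  have q: "q \<ge> 2" unfolding q_def by (rule two[OF Z(1) finZ])
  obtain n where n: "card A = q ^ n"
    using card_eq_power_of_scalars[OF Z(1) fin AD(1)] Z(2) AD(3,4) unfolding q_def by blast
  have "Z \<noteq> A" using nc xy by (auto simp: Z_def rel_center_def)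
  then have "Z \<subset> A" using Z(2) by blast
  from psubset_card_mono[OF fin this] have "q ^ 1 < q ^ n" by (simp add: q_def n)
  then have n2: "n \<ge> 2"
    using q by (subst (asm) power_strict_increasing_iff) auto
  obtain \<Phi> :: int where \<Phi>: "\<bar>\<Phi>\<bar> > int q - 1"
    and \<Phi>_dvd: "\<And>d. d dvd n \<Longrightarrow> d < n \<Longrightarrow> \<exists>s. int q ^ n - 1 = (int q ^ d - 1) * s * \<Phi>"
    using ex_cyclotomic_value[OF q n2] by metis
  \<comment> \<open>Conjugacy among noncentral elements; its classes are the noncentral terms of the
    class equation.\<close>
  define r where "r = {(x, y). x \<in> A - Z \<and> y \<in> A - Z \<and> (\<exists>a\<in>A - {0}. y = a * x * inverse a)}"
  have conj: "a * x * inverse a \<in> A - Z" if x: "x \<in> A - Z" and a: "a \<in> A - {0}" for a x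
  proof -
    have "x \<in> Z" if "a * x * inverse a \<in> Z"
    proof -
      have "x = inverse a * (a * x * inverse a) * a"
        using a by (simp add: mult.assoc inverse_mult_cancel_left)
      also have "\<dots> = a * x * inverse a"
        using that a rel_center_commute[of "a * x * inverse a" A a]
        unfolding Z_def by (simp only: mult.assoc) (simp add: inverse_mult_cancel_left)
      finally show ?thesis using that by simp
    qed
    moreover have "a * x * inverse a \<in> A" using x a by (auto intro!: AD)
    ultimately show ?thesis using x by blast
  qed
  have equiv: "equiv (A - Z) r"
  proof (rule equivI)
    show "r \<subseteq> (A - Z) \<times> (A - Z)" by (auto simp: r_def)
    show "refl_on (A - Z) r"
      using AD(2) by (auto simp: r_def refl_on_def intro!: bexI[of _ 1])
    show "sym r"
    proof (rule symI)
      fix x y assume "(x, y) \<in> r"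
      then obtain a where a: "x \<in> A - Z" "y \<in> A - Z" "a \<in> A - {0}" "y = a * x * inverse a"
        by (auto simp: r_def)
      then have "x = inverse a * y * inverse (inverse a)"
        by (simp add: mult.assoc inverse_mult_cancel_left)
      moreover have "inverse a \<in> A - {0}" using a AD(6) by simp
      ultimately show "(y, x) \<in> r"
        using a(1,2) unfolding r_def by blast
    qed
    show "trans r"
    proof (rule transI)
      fix x y z assume "(x, y) \<in> r" "(y, z) \<in> r"
      then obtain a b where a: "x \<in> A - Z" "z \<in> A - Z" "a \<in> A - {0}" "b \<in> A - {0}"
        "y = a * x * inverse a" "z = b * y * inverse b"
        by (auto simp: r_def)
      then have "z = (b * a) * x * inverse (b * a)"
        by (simp add: nonzero_inverse_mult_distrib mult.assoc)
      moreover have "b * a \<in> A - {0}" using a AD(4) by simp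
      ultimately show "(x, z) \<in> r"
        using a(1,2) unfolding r_def by blast
    qed
  qed
  have "nat \<bar>\<Phi>\<bar> dvd card X" if hX: "X \<in> (A - Z) // r" for X
  proof -
    obtain x where x: "x \<in> A - Z" and "X = r `` {x}"
      using hX by (elim quotientE)
    then have X: "X = (\<lambda>a. a * x * inverse a) ` (A - {0})"
      using conj by (auto simp: r_def)
    define C where "C = {z \<in> A. z * x = x * z}"
    have C: "is_division_subring C"
      using division_subring_centralizer[OF A, of "{x}"] by (simp add: C_def)
    obtain y where "y \<in> A" "x * y \<noteq> y * x"
      using x by (auto simp: Z_def rel_center_def)
    then have "y \<in> A - C" by (auto simp: C_def)
    then have CA: "C \<subset> A" by (auto simp: C_def)
    have finC: "finite C" using fin CA by (auto intro: finite_subset)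
    obtain d where d: "card C = q ^ d"
    proof -
      have "Z \<subseteq> C" using x by (auto simp: Z_def C_def rel_center_def)
      then show thesis
        using that card_eq_power_of_scalars[OF Z(1) finC division_subringD(1)[OF C]]
          division_subringD(3,4)[OF C] unfolding q_def by blast
    qed
    \<comment> \<open>\<open>A\<close> is also a vector space over the centralizer \<open>C\<close>.
      This makes \<open>d\<close> a divisor of \<open>n\<close>, and a proper one since
      \<open>C\<close> is not all of \<open>A\<close>.\<close>
    obtain k where k: "card A = card C ^ k"
      using card_eq_power_of_scalars[OF C fin AD(1)] CA AD(3,4) by blast
    then have "q ^ n = q ^ (d * k)" by (simp add: n d power_mult)
    then have "d dvd n" using q by (simp add: power_inject_exp)
    moreover have "d < n"
      using psubset_card_mono[OF fin CA] q unfolding n d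
      by (subst (asm) power_strict_increasing_iff) auto
    ultimately obtain s where s: "int q ^ n - 1 = (int q ^ d - 1) * s * \<Phi>"
      using \<Phi>_dvd by blast
    have "card X * (q ^ d - 1) = q ^ n - 1"
      using card_conjugacy_class[OF A fin, of x] x unfolding X d[symmetric] n[symmetric] C_def by simp
    then have "int (card X) * int (q ^ d - 1) = int (q ^ n - 1)"
      by (metis of_nat_mult)
    moreover have qd: "q ^ d \<ge> 2" "q ^ n \<ge> 1" using two[OF C finC] d q by simp_all
    ultimately have "int (card X) * (int q ^ d - 1) = int q ^ n - 1"
      by (simp add: of_nat_diff)
    then have "(int q ^ d - 1) * int (card X) = (int q ^ d - 1) * (s * \<Phi>)"
      by (simp add: s mult.commute mult.left_commute)
    moreover have "int q ^ d - 1 \<noteq> 0"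
      using qd(1) by (metis of_nat_power of_nat_1 of_nat_eq_iff right_minus_eq one_le_numeral
          numeral_le_one_iff semiring_norm(69))
    ultimately have "int (card X) = s * \<Phi>" by simp
    then show ?thesis by (metis dvd_triv_right int_dvd_int_iff abs_dvd_iff nat_abs_dvd_iff)
  qed
  \<comment> \<open>The classes partition \<open>A - Z\<close>, which has \<open>q^n - q\<close>
    elements; the difference to \<open>q^n - 1\<close> is \<open>q - 1\<close>.\<close>
  then have "nat \<bar>\<Phi>\<bar> dvd card (A - Z)"
    by (intro equiv_imp_dvd_card[OF _ equiv]) (use fin in auto)
  also have "card (A - Z) = q ^ n - q"
    using card_Diff_subset[OF finZ Z(2)] by (simp add: n q_def)
  finally have "\<Phi> dvd int (q ^ n - q)"
    by (metis abs_dvd_iff int_dvd_int_iff int_nat_eq abs_ge_zero)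
  moreover have "q \<le> q ^ n" using q n2 by (intro self_le_power) auto
  ultimately have 1: "\<Phi> dvd int q ^ n - int q" by (simp add: of_nat_diff)
  obtain s where "int q ^ n - 1 = (int q ^ 1 - 1) * s * \<Phi>"
    using \<Phi>_dvd[of 1] n2 by auto
  then have "\<Phi> dvd int q ^ n - 1" by simp
  from dvd_diff[OF this 1] have "\<Phi> dvd int q - 1" by simp
  from dvd_imp_le_int[OF _ this] \<Phi> q show False by simp
qed

section \<open>Torsion elements conjugate to their powers\<close>

text \<open>With \<open>a\<close> fixed, centrality of its commutators with both \<open>b\<close>
  and \<open>b + 1\<close> would put \<open>b\<close> into the center.\<close>

lemma ex_noncentral_commutator:
  fixes a b :: "'a::division_ring"
  assumes K: "is_division_subring K" and ab: "a \<in> K" "b \<in> K" "a * b \<noteq> b * a"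
  shows "\<exists>b\<in>K. b \<noteq> 0 \<and> a * b * inverse a * inverse b \<notin> rel_center K"
proof (rule ccontr)
  assume "\<not> ?thesis"
  then have central: "a * b * inverse a * inverse b \<in> rel_center K" if "b \<in> K" "b \<noteq> 0" for b
    using that by blast
  have a: "a \<noteq> 0" and b: "b \<noteq> 0" using ab(3) by auto
  have b1: "b + 1 \<noteq> 0"
  proof
    assume "b + 1 = 0"
    then have "b = - 1" by (simp add: eq_neg_iff_add_eq_0)
    with ab(3) show False by simp
  qed
  note Z = division_subringD[OF division_subring_rel_center[OF K]]
  define c where "c = a * b * inverse a * inverse b"
  \<comment> \<open>Both commutators together determine \<open>b\<close>, by \<open>(d - c) b = 1 - d\<close>.\<close>
  define d where "d = a * (b + 1) * inverse a * inverse (b + 1)"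
  have cZ: "c \<in> rel_center K" and dZ: "d \<in> rel_center K"
    unfolding c_def d_def using ab b b1 division_subringD(2,3)[OF K] by (auto intro!: central)
  have c: "c * b = a * b * inverse a"
    using b by (simp add: c_def mult.assoc)
  have "d * (b + 1) = a * (b + 1) * inverse a"
    using b1 by (simp add: d_def mult.assoc)
  also have "\<dots> = c * b + 1"
    using a by (simp add: c distrib_left distrib_right)
  finally have eq: "(d - c) * b = 1 - d"
    by (simp add: algebra_simps)
  have "d \<noteq> c"
  proof
    assume "d = c"
    with eq have "c = 1" by simp
    with c have "a * b * inverse a * a = b * a" by simp
    with a ab(3) show False by (simp add: mult.assoc)
  qed
  then have "b = inverse (d - c) * (1 - d)"
    by (simp add: eq[symmetric] inverse_mult_cancel_left)
  also have "\<dots> \<in> rel_center K"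
    by (intro Z cZ dZ)
  finally show False
    using rel_center_commute[of b K a] ab by simp
qed

section \<open>Binomial expansion and torsion in prime characteristic\<close>

lemma one_plus_power:
  fixes t :: "'a::ring_1"
  shows "(1 + t) ^ m = (\<Sum>k\<le>m. of_nat (m choose k) * t ^ k)"
proof (induction m)
  case (Suc m)
  have comm: "t * (of_nat c * x) = of_nat c * (t * x)" for c x
    by (metis mult.assoc mult_of_nat_commute)
  have "(1 + t) ^ Suc m = (\<Sum>k\<le>m. of_nat (m choose k) * t ^ k) + (\<Sum>k\<le>m. of_nat (m choose k) * t ^ Suc k)"
    by (simp add: Suc distrib_right sum_distrib_left comm sum.distrib)
  also have "(\<Sum>k\<le>m. of_nat (m choose k) * t ^ k) = 1 + (\<Sum>k\<le>m. of_nat (m choose Suc k) * t ^ Suc k)"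
    using sum.atMost_Suc_shift[of "\<lambda>k. of_nat (m choose k) * t ^ k" m] by (simp add: binomial_eq_0)
  also have "\<dots> + (\<Sum>k\<le>m. of_nat (m choose k) * t ^ Suc k) = (\<Sum>k\<le>Suc m. of_nat (Suc m choose k) * t ^ k)"
    by (subst sum.atMost_Suc_shift) (simp add: distrib_right sum.distrib add.assoc add.commute)
  finally show ?case .
qed simp

text \<open>In characteristic \<open>p\<close> the middle binomial coefficients vanish, so
  \<open>(v - 1) ^ p = v ^ p - 1 = 0\<close>.\<close>

lemma prime_char_power_eq_1:
  fixes v :: "'a::division_ring"
  assumes p: "prime p" "of_nat p = (0::'a)" and v: "v ^ p = 1"
  shows "v = 1"
proof -
  define t where "t = v - 1"
  have "of_nat (p choose k) * t ^ k = 0" if "k \<in> {..p} - {0, p}" for k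
  proof -
    have "p dvd (p choose k)"
      using that p(1) by (intro dvd_choose_prime) auto
    then obtain c where "p choose k = p * c" by (elim dvdE)
    then show ?thesis using p by simp
  qed
  then have "(\<Sum>k\<le>p. of_nat (p choose k) * t ^ k) = (\<Sum>k\<in>{0, p}. of_nat (p choose k) * t ^ k)"
    by (intro sum.mono_neutral_right) auto
  also have "\<dots> = 1 + t ^ p"
    using prime_gt_0_nat[OF p(1)] by simp
  finally have "(1 + t) ^ p = 1 + t ^ p"
    by (simp add: one_plus_power)
  then have "t ^ p = 0"
    using v by (simp add: t_def)
  then show ?thesis by (simp add: t_def)
qed

lemma ex_prime_dvd_of_nat_eq_0:
  assumes "n > 0" "of_nat n = (0::'a::division_ring)"
  shows "\<exists>p. prime p \<and> p dvd n \<and> of_nat p = (0::'a)"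
  using assms
proof (induction n rule: less_induct)
  case (less n)
  have "n \<noteq> 1" using less.prems by auto
  then obtain p where p: "prime p" "p dvd n" using prime_factor_nat by blast
  then obtain m where m: "n = p * m" by (elim dvdE)
  have "(of_nat p :: 'a) * of_nat m = 0" using less.prems m by simp
  then consider "of_nat p = (0::'a)" | "of_nat m = (0::'a)" by auto
  then show ?case
  proof cases
    case 2
    have "m < n" "m > 0" using m less.prems prime_gt_1_nat[OF p(1)] by auto
    from less.IH[OF this 2] show ?thesis using m by auto
  qed (use p in auto)
qed

text \<open>Here \<open>n\<close> is the exact order of \<open>u\<close>. If the characteristic
  \<open>p\<close> divided \<open>n\<close>, then \<open>u ^ (n div p)\<close> would be a
  \<open>p\<close>-th root of \<open>1\<close>, hence equal to \<open>1\<close>, against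
  minimality.\<close>

lemma of_nat_order_neq_0:
  fixes u :: "'a::division_ring"
  assumes n: "n > 0" "u ^ n = 1" and min: "\<And>k. 0 < k \<Longrightarrow> k < n \<Longrightarrow> u ^ k \<noteq> 1"
  shows "of_nat n \<noteq> (0::'a)"
proof
  assume "of_nat n = (0::'a)"
  then obtain p where p: "prime p" "p dvd n" "of_nat p = (0::'a)"
    using ex_prime_dvd_of_nat_eq_0 n(1) by blast
  then obtain m where m: "n = p * m" by (elim dvdE)
  have "(u ^ m) ^ p = 1" using n m by (simp add: power_mult[symmetric] mult.commute)
  from prime_char_power_eq_1[OF p(1,3) this] show False
    using min[of m] m n prime_gt_1_nat[OF p(1)] by auto
qed

lemma geometric_sum_ring: "(x - 1) * (\<Sum>j<n. x ^ j) = x ^ n - (1 :: 'a::ring_1)"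
  by (induction n) (auto simp: algebra_simps)

text \<open>Some \<open>w\<close> does not commute with \<open>u\<close>. Its eigencomponents
  \<open>y j\<close> add up to \<open>of_nat n * w\<close>; if all those with
  \<open>u ^ j \<noteq> u\<close> vanished, the sum would commute with \<open>u\<close>, and so
  would \<open>w\<close>, because \<open>n\<close> is nonzero in the ring.\<close>

lemma torsion_conjugate_to_power:
  fixes u :: "'a::division_ring"
  assumes K: "is_division_subring K" and u: "u \<in> K" "u \<notin> rel_center K"
    and tors: "m > 0" "u ^ m = 1"
  shows "\<exists>g\<in>K. \<exists>j. g \<noteq> 0 \<and> g * u = u ^ j * g \<and> u ^ j \<noteq> u"
proof -
  define n where "n = (LEAST n. n > 0 \<and> u ^ n = 1)"
  have n: "n > 0" "u ^ n = 1"
    using LeastI[of "\<lambda>n. n > 0 \<and> u ^ n = 1" m] tors unfolding n_def by auto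
  have min: "u ^ k \<noteq> 1" if "0 < k" "k < n" for k
    using not_less_Least[of k "\<lambda>n. n > 0 \<and> u ^ n = 1"] that unfolding n_def by auto
  have u0: "u \<noteq> 0" using n by (auto simp: power_0_left)
  obtain w where w: "w \<in> K" "u * w \<noteq> w * u"
    using u by (auto simp: rel_center_def)
  define v where "v = inverse u"
  have vn: "v ^ n = 1" using n by (simp add: v_def power_inverse)
  \<comment> \<open>\<open>y j\<close> is \<open>n\<close> times the component of \<open>w\<close> in the eigenspace \<open>{y. y u = u\<^sup>j y}\<close>.\<close>
  define F where "F j k = u ^ (j * k) * w * v ^ k" for j k
  define y where "y j = (\<Sum>k<n. F j k)" for j
  have y: "y j * u = u ^ j * y j" for j
  proof -
    \<comment> \<open>\<open>F j\<close> has period \<open>n\<close>, so shifting the summation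
      index fixes \<open>y j\<close>; the shift is \<open>\<lambda>x. u ^ j * x * v\<close>.\<close>
    have "F j n = F j 0"
      using n vn by (simp add: F_def mult.commute[of j] power_mult)
    then have "(\<Sum>k<n. F j (Suc k)) = y j"
      using sum.lessThan_Suc_shift[of "F j" n] by (simp add: y_def)
    moreover have "F j (Suc k) = u ^ j * F j k * v" for k
      by (simp add: F_def power_add mult.assoc power_Suc2 del: power_Suc)
    ultimately have "u ^ j * y j * v = y j"
      by (simp add: y_def sum_distrib_left sum_distrib_right)
    then have "y j * u = u ^ j * y j * v * u" by simp
    then show ?thesis using u0 by (simp add: v_def mult.assoc)
  qed
  \<comment> \<open>Summing over \<open>j\<close> first leaves only \<open>k = 0\<close>: for
    \<open>0 < k < n\<close> the geometric sum of \<open>u ^ k\<close> vanishes, as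
    \<open>u ^ k \<noteq> 1\<close>.\<close>
  have "(\<Sum>j<n. y j) = (\<Sum>k<n. \<Sum>j<n. F j k)"
    unfolding y_def by (rule sum.swap)
  also have "\<dots> = (\<Sum>k<n. (\<Sum>j<n. (u ^ k) ^ j) * w * v ^ k)"
    by (simp add: F_def sum_distrib_right power_mult[symmetric] mult.commute)
  also have "\<dots> = (\<Sum>k<n. if k = 0 then of_nat n * w else 0)"
  proof (intro sum.cong refl)
    fix k assume k: "k \<in> {..<n}"
    show "(\<Sum>j<n. (u ^ k) ^ j) * w * v ^ k = (if k = 0 then of_nat n * w else 0)"
    proof (cases "k = 0")
      case False
      have "(u ^ k - 1) * (\<Sum>j<n. (u ^ k) ^ j) = 0"
        unfolding geometric_sum_ring using n by (simp add: power_mult[symmetric] mult.commute[of k]) (simp add: power_mult)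
      with min[of k] k False show ?thesis by simp
    qed simp
  qed
  also have "\<dots> = of_nat n * w"
    using n by simp
  finally have sum: "(\<Sum>j<n. y j) = of_nat n * w" .
  have "\<exists>j. u ^ j \<noteq> u \<and> y j \<noteq> 0"
  proof (rule ccontr)
    assume "\<nexists>j. u ^ j \<noteq> u \<and> y j \<noteq> 0"
    then have "y j * u = u * y j" for j
      using y[of j] by (cases "y j = 0") auto
    then have "of_nat n * w * u = u * (of_nat n * w)"
      by (simp add: sum[symmetric] sum_distrib_left sum_distrib_right)
    then have "of_nat n * (w * u) = of_nat n * (u * w)"
      by (metis mult.assoc mult_of_nat_commute)
    with of_nat_order_neq_0[OF n min] w show False by simp
  qed
  then obtain j where j: "u ^ j \<noteq> u" "y j \<noteq> 0" by blast
  have "y j \<in> K"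
    unfolding y_def F_def v_def using u(1) w(1)
    by (intro division_subring_sum[OF K] division_subringD[OF K])
  with j y show ?thesis by blast
qed

section \<open>Characteristic zero\<close>

lemma mult_of_int_left_commute: "x * (of_int k * y) = of_int k * (x * (y :: 'a::ring_1))"
  by (metis mult.assoc mult_of_int_commute)

text \<open>Modulo 3 the matrix is diagonal with units on the diagonal, so it is nonsingular over
  the integers. Eliminating the last unknown preserves this shape.\<close>

lemma linear_system_diagonal_mod_3:
  fixes v :: "nat \<Rightarrow> 'a::division_ring" and c :: "nat \<Rightarrow> nat \<Rightarrow> int"
  assumes char0: "\<And>k::int. of_int k = (0::'a) \<Longrightarrow> k = 0"
    and "\<And>i. i < m \<Longrightarrow> (\<Sum>j<m. of_int (c i j) * v j) = 0"
    and "\<And>i. i < m \<Longrightarrow> \<not> 3 dvd c i i"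
    and "\<And>i j. i < m \<Longrightarrow> j < m \<Longrightarrow> i \<noteq> j \<Longrightarrow> 3 dvd c i j"
    and "i < m"
  shows "v i = 0"
  using assms(2-)
proof (induction m arbitrary: c i)
  case (Suc m)
  \<comment> \<open>Fraction-free elimination with pivot \<open>c m m\<close>, which keeps the
    coefficients integral.\<close>
  define c' where "c' i j = c m m * c i j - c i m * c m j" for i j
  have prime3: "prime (3::int)" by simp
  have IH: "v i = 0" if "i < m" for i
  proof (rule Suc.IH[of c', OF _ _ _ that])
    fix i assume i: "i < m"
    have rows: "(\<Sum>j<m. of_int (c k j) * v j) = - (of_int (c k m) * v m)" if "k < Suc m" for k
      using Suc.prems(1)[OF that] by (simp add: eq_neg_iff_add_eq_0)
    have "(\<Sum>j<m. of_int (c' i j) * v j) =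
        of_int (c m m) * (\<Sum>j<m. of_int (c i j) * v j) - of_int (c i m) * (\<Sum>j<m. of_int (c m j) * v j)"
      by (simp add: c'_def left_diff_distrib sum_subtractf sum_distrib_left mult.assoc)
    also have "\<dots> = of_int (c i m * c m m - c m m * c i m) * v m"
      using rows[of i] rows[of m] i by (simp add: left_diff_distrib mult.assoc[symmetric]) (metis mult_of_int_commute)
    finally show "(\<Sum>j<m. of_int (c' i j) * v j) = 0" by (simp add: mult.commute)
    \<comment> \<open>The subtracted term is a product of off-diagonal entries, so the new diagonal
      entry is still prime to 3.\<close>
    have "3 dvd c i m * c m i" "\<not> 3 dvd c m m * c i i"
      using Suc.prems i by (auto simp: prime_dvd_mult_iff[OF prime3])
    then show "\<not> 3 dvd c' i i" by (simp add: c'_def dvd_diff_left_iff)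
  next
    fix i j assume "i < m" "j < m" "i \<noteq> j"
    then show "3 dvd c' i j"
      using Suc.prems(3) by (auto simp: c'_def intro!: dvd_diff dvd_mult dvd_mult2)
  qed
  moreover have "v m = 0"
  proof -
    have "of_int (c m m) * v m = 0"
      using Suc.prems(1)[of m] IH by simp
    moreover have "c m m \<noteq> 0" using Suc.prems(2)[of m] by auto
    ultimately show ?thesis using char0 by auto
  qed
  ultimately show ?case using Suc.prems(4) by (auto simp: less_Suc_eq)
qed simp

section \<open>The ring of integer combinations of powers of a root of unity\<close>

definition int_span :: "'a::ring_1 \<Rightarrow> nat \<Rightarrow> 'a set" where
  "int_span u n = range (\<lambda>f :: nat \<Rightarrow> int. \<Sum>i<n. of_int (f i) * u ^ i)"

lemma int_span_add: "x \<in> int_span u n \<Longrightarrow> y \<in> int_span u n \<Longrightarrow> x + y \<in> int_span u n"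
proof -
  assume "x \<in> int_span u n" "y \<in> int_span u n"
  then obtain f g where "x = (\<Sum>i<n. of_int (f i) * u ^ i)" "y = (\<Sum>i<n. of_int (g i) * u ^ i)"
    by (auto simp: int_span_def)
  then have "x + y = (\<Sum>i<n. of_int (f i + g i) * u ^ i)"
    by (simp add: distrib_right sum.distrib)
  then show ?thesis unfolding int_span_def by (rule range_eqI[where x = "\<lambda>i. f i + g i"])
qed

lemma int_span_scale: "x \<in> int_span u n \<Longrightarrow> of_int k * x \<in> int_span u n"
proof -
  assume "x \<in> int_span u n"
  then obtain f where "x = (\<Sum>i<n. of_int (f i) * u ^ i)"
    by (auto simp: int_span_def)
  then have "of_int k * x = (\<Sum>i<n. of_int (k * f i) * u ^ i)"
    by (simp add: sum_distrib_left mult.assoc)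
  then show ?thesis unfolding int_span_def by (rule range_eqI[where x = "\<lambda>i. k * f i"])
qed

lemma int_span_0: "0 \<in> int_span u n"
  unfolding int_span_def by (rule range_eqI[of _ _ "\<lambda>_. 0"]) simp

lemma int_span_sum: "(\<And>i. i \<in> I \<Longrightarrow> f i \<in> int_span u n) \<Longrightarrow> sum f I \<in> int_span u n"
  by (induction I rule: infinite_finite_induct) (auto simp: int_span_add int_span_0)

lemma int_span_power:
  assumes "n > 0" "u ^ n = 1"
  shows "u ^ k \<in> int_span u n"
proof -
  have "u ^ k = u ^ (n * (k div n) + k mod n)" by simp
  also have "\<dots> = u ^ (k mod n)" using assms by (simp only: power_add power_mult) simp
  also have "\<dots> = (\<Sum>i<n. of_int (if i = k mod n then 1 else 0) * u ^ i)"
    using assms by (simp add: if_distrib[of of_int] if_distrib[of "\<lambda>x. x * _"] cong: if_cong)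
  finally show ?thesis
    unfolding int_span_def by (rule range_eqI[where x = "\<lambda>i. if i = k mod n then 1 else 0"])
qed

lemma int_span_mult:
  assumes n: "n > 0" "u ^ n = 1" and x: "x \<in> int_span u n" and y: "y \<in> int_span u n"
  shows "x * y \<in> int_span u n"
proof -
  obtain f g where fg: "x = (\<Sum>i<n. of_int (f i) * u ^ i)" "y = (\<Sum>i<n. of_int (g i) * u ^ i)"
    using x y by (auto simp: int_span_def)
  have "x * y = (\<Sum>i<n. \<Sum>j<n. of_int (f i) * u ^ i * (of_int (g j) * u ^ j))"
    by (simp add: fg sum_product)
  also have "\<dots> = (\<Sum>i<n. \<Sum>j<n. of_int (f i) * (of_int (g j) * u ^ (i + j)))"
    by (simp add: mult.assoc mult_of_int_left_commute[of "u ^ _"] power_add)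
  also have "\<dots> \<in> int_span u n"
    by (intro int_span_sum int_span_scale int_span_power n)
  finally show ?thesis .
qed

lemma mult_3_commute:
  fixes x y :: "'a::ring_1"
  shows "x * 3 = 3 * x" "x * (3 * y) = 3 * (x * y)"
proof -
  show "x * 3 = 3 * x" for x :: 'a
    by (metis mult_of_int_commute of_int_numeral)
  then show "x * (3 * y) = 3 * (x * y)"
    by (metis mult.assoc)
qed

text \<open>A determinant trick: if \<open>3 * x = 1\<close>, then
  \<open>u ^ k = 3 * (u ^ k * x)\<close>, and expanding \<open>u ^ k * x\<close> gives an integral
  linear system for the powers of \<open>u\<close> whose matrix is minus the identity modulo 3. All
  powers would then vanish.\<close>

lemma not_3_dvd_1_int_span:
  fixes u :: "'a::division_ring"
  assumes char0: "\<And>k::int. of_int k = (0::'a) \<Longrightarrow> k = 0" and n: "n > 0" "u ^ n = 1"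
    and x: "x \<in> int_span u n"
  shows "3 * x \<noteq> 1"
proof
  assume x3: "3 * x = 1"
  have "u ^ k * x \<in> int_span u n" for k
    by (intro int_span_mult int_span_power n x)
  then have "\<exists>f :: nat \<Rightarrow> int. u ^ k * x = (\<Sum>i<n. of_int (f i) * u ^ i)" for k
    unfolding int_span_def by blast
  then obtain f :: "nat \<Rightarrow> nat \<Rightarrow> int"
    where f: "\<And>k. u ^ k * x = (\<Sum>i<n. of_int (f k i) * u ^ i)" by metis
  define c where "c k i = 3 * f k i - (if i = k then 1 else 0)" for k i
  have "(\<Sum>i<n. of_int (c k i) * u ^ i) = 0" if k: "k < n" for k
  proof -
    have "(\<Sum>i<n. of_int (c k i) * u ^ i) =
        3 * (\<Sum>i<n. of_int (f k i) * u ^ i) - (\<Sum>i<n. of_int (if i = k then 1 else 0) * u ^ i)"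
      by (simp add: c_def left_diff_distrib sum_subtractf sum_distrib_left mult.assoc)
    also have "(\<Sum>i<n. of_int (if i = k then 1 else 0) * u ^ i) = u ^ k"
      using k by (simp add: if_distrib[of of_int] if_distrib[of "\<lambda>x. x * _"] cong: if_cong)
    also have "3 * (\<Sum>i<n. of_int (f k i) * u ^ i) = u ^ k"
      unfolding f[symmetric] mult_3_commute(2)[of "u ^ k" x, symmetric] x3 by simp
    finally show ?thesis by simp
  qed
  then have "u ^ 0 = 0"
  proof (intro linear_system_diagonal_mod_3[where m = n and c = c and v = "\<lambda>i. u ^ i" and i = 0] char0)
    show "\<not> 3 dvd c i i" for i by (simp add: c_def) presburger
  qed (use n in \<open>auto simp: c_def\<close>)
  then show False by simp
qed

text \<open>Minkowski's argument that the elements congruent to \<open>1\<close> modulo 3 contain no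
  torsion but \<open>1\<close>. \<open>R\<close> is a subring in which 3 is not invertible; a
  nontrivial torsion element would produce an inverse of 3.\<close>

lemma torsion_eq_1_mod_3:
  fixes w :: "'a::division_ring"
  assumes R: "1 \<in> R" "\<And>x y. x \<in> R \<Longrightarrow> y \<in> R \<Longrightarrow> x + y \<in> R" "\<And>x y. x \<in> R \<Longrightarrow> y \<in> R \<Longrightarrow> x * y \<in> R"
      "\<And>x. x \<in> R \<Longrightarrow> - x \<in> R" "\<And>x. x \<in> R \<Longrightarrow> 3 * x \<noteq> 1"
    and 3: "(3::'a) \<noteq> 0" and w: "w \<in> R" and m: "m > 0" "(1 + 3 * w) ^ m = 1"
  shows "w = 0"
proof (rule ccontr)
  assume w0: "w \<noteq> 0"
  have R0: "0 \<in> R" using R(2)[OF R(1) R(4)[OF R(1)]] by simp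
  have Rnat: "of_nat k \<in> R" for k by (induction k) (auto simp: R0 R(1,2))
  then have Rint: "of_int k \<in> R" for k by (cases k) (auto simp: R(4) simp del: of_nat_Suc)
  have R3: "3 \<in> R" using Rint[of 3] by simp
  \<comment> \<open>The binomial expansion up to its linear term, with the factor \<open>x\<close>
    split off so that it can be cancelled.\<close>
  have pow: "\<exists>r\<in>R. (1 + 3 * x) ^ k = 1 + 3 * (x * (of_nat k + 3 * r))" if x: "x \<in> R" for x k
  proof (induction k)
    case 0
    show ?case using R0 by (intro bexI[of _ 0]) auto
  next
    case (Suc k)
    then obtain r where r: "r \<in> R" "(1 + 3 * x) ^ k = 1 + 3 * (x * (of_nat k + 3 * r))" by blast
    define p where "p = of_nat k + 3 * r"
    have "(1 + 3 * x) ^ Suc k = (1 + 3 * x) * (1 + 3 * (x * p))"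
      by (simp add: r(2) p_def)
    also have "\<dots> = 1 + 3 * (x * (1 + p + 3 * (x * p)))"
      by (simp add: distrib_left distrib_right mult.assoc mult_3_commute(2)[of x] add_ac)
    also have "1 + p + 3 * (x * p) = of_nat (Suc k) + 3 * (r + x * (of_nat k + 3 * r))"
      by (simp add: p_def distrib_left add_ac)
    finally have "(1 + 3 * x) ^ Suc k = 1 + 3 * (x * (of_nat (Suc k) + 3 * (r + x * (of_nat k + 3 * r))))" .
    moreover have "r + x * (of_nat k + 3 * r) \<in> R"
      by (intro R(2,3) x r R3 Rnat)
    ultimately show ?case by blast
  qed
  define k where "k = (LEAST k. k > 0 \<and> (1 + 3 * w) ^ k = 1)"
  have k: "k > 0" "(1 + 3 * w) ^ k = 1"
    using LeastI[of "\<lambda>k. k > 0 \<and> (1 + 3 * w) ^ k = 1" m] m unfolding k_def by auto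
  have min: "(1 + 3 * w) ^ i \<noteq> 1" if "0 < i" "i < k" for i
    using not_less_Least[of i "\<lambda>k. k > 0 \<and> (1 + 3 * w) ^ k = 1"] that unfolding k_def by auto
  \<comment> \<open>Reduction to prime order \<open>q\<close>: the power with exponent
    \<open>k div q\<close> is again of the form \<open>1 + 3 * x\<close> with \<open>x\<close>
    nonzero in \<open>R\<close>.\<close>
  have "k \<noteq> 1" using k w0 3 by auto
  then obtain q where q: "prime q" "q dvd k" using prime_factor_nat by blast
  then obtain i where i: "k = q * i" by (elim dvdE)
  then have i': "0 < i" "i < k" using k prime_gt_1_nat[OF q(1)] by auto
  obtain r where r: "r \<in> R" "(1 + 3 * w) ^ i = 1 + 3 * (w * (of_nat i + 3 * r))"
    using pow[OF w] by blast
  define x where "x = w * (of_nat i + 3 * r)"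
  have x: "x \<in> R" unfolding x_def by (intro R(2,3) w Rnat r R3)
  have x0: "x \<noteq> 0" using min[OF i'] r by (auto simp: x_def)
  have xq: "(1 + 3 * x) ^ q = 1"
  proof -
    have "((1 + 3 * w) ^ i) ^ q = 1"
      using k(2) i by (simp add: power_mult[symmetric] mult.commute)
    then show ?thesis
      unfolding r(2) x_def .
  qed
  show False
  proof (cases "q = 3")
    case True
    \<comment> \<open>For \<open>q = 3\<close> the linear term is itself a multiple of 3, so the
      full sum \<open>1 + (1 + s) + (1 + s)^2 = 3 * (1 + s + x * s)\<close> is needed.\<close>
    define s where "s = 3 * x"
    have "s * (\<Sum>i<3. (1 + s) ^ i) = 0"
      using geometric_sum_ring[of "1 + s" 3] xq True by (simp add: s_def)
    then have "0 = (\<Sum>i<3. (1 + s) ^ i)"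
      using 3 x0 by (simp add: s_def)
    also have "\<dots> = (1 + 1 + 1) + (s + s + s) + s * s"
      by (simp add: eval_nat_numeral distrib_left distrib_right add_ac)
    also have "\<dots> = 3 * 1 + 3 * s + 3 * (x * s)"
    proof -
      have "(3::'a) = 1 + 1 + 1" by simp
      then have "3 * y = y + y + y" for y :: 'a by (simp only: distrib_right mult_1_left)
      moreover have "s * s = 3 * (x * s)" by (simp add: s_def mult.assoc)
      ultimately show ?thesis by (simp only:)
    qed
    finally have "3 * (1 + s + x * s) = 0"
      by (simp only: distrib_left)
    with 3 have "1 + s + x * s = 0" by (simp only: mult_eq_0_iff simp_thms)
    then have "3 * (x + x * x) = - 1"
      by (simp add: s_def distrib_left mult_3_commute(2)[of x] eq_neg_iff_add_eq_0 add_ac)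
    then have "3 * (- (x + x * x)) = 1" by (simp only: mult_minus_right minus_minus)
    moreover have "- (x + x * x) \<in> R" by (intro R(2-4) x)
    ultimately show False using R(5) by blast
  next
    case False
    obtain s where s: "s \<in> R" "(1 + 3 * x) ^ q = 1 + 3 * (x * (of_nat q + 3 * s))"
      using pow[OF x] by blast
    with xq 3 x0 have qs: "of_nat q = - (3 * s)" by (simp add: eq_neg_iff_add_eq_0)
    \<comment> \<open>\<open>q\<close> is a multiple of 3 in \<open>R\<close> and prime to 3, so
      Bezout yields an inverse of 3 in \<open>R\<close>.\<close>
    have "coprime (int q) 3"
      by (rule primes_coprime) (use False q(1) in auto)
    then obtain a b where ab: "a * int q + b * 3 = 1"
      using bezout_int[of "int q" 3] by auto
    have "(of_int (a * int q + b * 3) :: 'a) = 3 * (- (of_int a * s) + of_int b)"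
      by (simp add: qs distrib_left mult_3_commute(2)[of "of_int a"] mult_3_commute(1)[of "of_int b"])
    then have "3 * (- (of_int a * s) + of_int b) = (1 :: 'a)" by (simp add: ab)
    moreover have "- (of_int a * s) + of_int b \<in> R" by (intro R(2-4) s Rint)
    ultimately show False using R(5) by blast
  qed
qed

text \<open>With \<open>e = 1 + 3 * u\<close>, the commutator of \<open>g\<close> and
  \<open>e\<close> is \<open>1 + 3 * ((u ^ j - u) * inverse e)\<close>, a torsion element congruent
  to \<open>1\<close> modulo 3, which forces \<open>u ^ j = u\<close>.\<close>

lemma char_0_contradiction:
  fixes u g :: "'a::division_ring"
  assumes char0: "\<And>k::int. of_int k = (0::'a) \<Longrightarrow> k = 0" and n: "n > 0" "u ^ n = 1"
    and g: "g \<noteq> 0" "g * u = u ^ j * g" "u ^ j \<noteq> u"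
    and u3: "1 + 3 * u \<noteq> 0"
    and m: "m > 0" "(g * (1 + 3 * u) * inverse g * inverse (1 + 3 * u)) ^ m = 1"
  shows False
proof -
  have 3: "(3::'a) \<noteq> 0" using char0[of 3] by auto
  define e where "e = 1 + 3 * u"
  have e0: "e \<noteq> 0" using u3 by (simp add: e_def)
  have gug: "g * u * inverse g = u ^ j" using g by (simp add: mult.assoc)
  \<comment> \<open>\<open>R\<close> is the ring \<open>\<int>[u]\<close> localized at the integers prime to 3.\<close>
  define R where "R = {x :: 'a. \<exists>D::int. \<not> 3 dvd D \<and> of_int D * x \<in> int_span u n}"
  have span_R: "x \<in> R" if "x \<in> int_span u n" for x
    unfolding R_def using that by (intro CollectI exI[of _ 1]) auto
  have prime3: "prime (3::int)" by simp
  have R1: "1 \<in> R" using span_R[OF int_span_power[OF n, of 0]] by simp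
  have Rneg: "- x \<in> R" if x: "x \<in> R" for x
  proof -
    obtain D :: int where D: "\<not> 3 dvd D" "of_int D * x \<in> int_span u n" using x by (auto simp: R_def)
    then show ?thesis unfolding R_def by (intro CollectI exI[of _ "- D"]) auto
  qed
  have Radd: "x + y \<in> R" if x: "x \<in> R" and y: "y \<in> R" for x y
  proof -
    obtain D E :: int where D: "\<not> 3 dvd D" "of_int D * x \<in> int_span u n" "\<not> 3 dvd E" "of_int E * y \<in> int_span u n"
      using x y by (auto simp: R_def)
    have "of_int (D * E) * (x + y) = of_int E * (of_int D * x) + of_int D * (of_int E * y)"
      by (simp add: distrib_left mult.assoc mult_of_int_left_commute[of "of_int E" D])
    also have "\<dots> \<in> int_span u n" by (intro int_span_add int_span_scale D)
    finally show ?thesis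
      unfolding R_def using D by (intro CollectI exI[of _ "D * E"]) (auto simp: prime_dvd_mult_iff[OF prime3])
  qed
  have Rmult: "x * y \<in> R" if x: "x \<in> R" and y: "y \<in> R" for x y
  proof -
    obtain D E :: int where D: "\<not> 3 dvd D" "of_int D * x \<in> int_span u n" "\<not> 3 dvd E" "of_int E * y \<in> int_span u n"
      using x y by (auto simp: R_def)
    have "of_int (D * E) * (x * y) = (of_int D * x) * (of_int E * y)"
      by (simp add: mult.assoc mult_of_int_left_commute[of x])
    also have "\<dots> \<in> int_span u n" by (intro int_span_mult[OF n] D)
    finally show ?thesis
      unfolding R_def using D by (intro CollectI exI[of _ "D * E"]) (auto simp: prime_dvd_mult_iff[OF prime3])
  qed
  have R3: "3 * x \<noteq> 1" if x: "x \<in> R" for x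
  proof
    assume x3: "3 * x = 1"
    obtain D :: int where D: "\<not> 3 dvd D" "of_int D * x \<in> int_span u n"
      using x by (auto simp: R_def)
    \<comment> \<open>The denominator \<open>D\<close> is prime to 3, so by Bezout an inverse of 3
      in \<open>R\<close> would give one in \<open>int_span u n\<close>.\<close>
    have "coprime D 3"
      using D(1) prime_imp_coprime[OF prime3, of D] by (simp add: coprime_commute)
    then obtain a b where ab: "a * D + b * 3 = 1"
      using bezout_int[of D 3] by auto
    have "3 * (of_int a * (of_int D * x) + of_int b * u ^ 0) = of_int (a * D + b * 3)"
    proof -
      have "3 * (of_int a * (of_int D * x)) = of_int a * (of_int D * (3 * x))"
        by (simp only: mult_3_commute(2)[of "of_int a"] mult_3_commute(2)[of "of_int D"])
      then show ?thesis
        by (simp add: distrib_left x3 mult_3_commute(1)[of "of_int b"])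
    qed
    then have "3 * (of_int a * (of_int D * x) + of_int b * u ^ 0) = 1"
      by (simp add: ab)
    moreover have "of_int a * (of_int D * x) + of_int b * u ^ 0 \<in> int_span u n"
      by (intro int_span_add int_span_scale D int_span_power n)
    ultimately show False using not_3_dvd_1_int_span[OF char0 n] by blast
  qed
  have "inverse e \<in> R"
  proof -
    \<comment> \<open>As \<open>e = 1 - t\<close> and \<open>u ^ n = 1\<close>, the geometric sum of
      \<open>t\<close> is \<open>inverse e\<close> times the integer \<open>1 - (- 3) ^ n\<close>,
      which is prime to 3.\<close>
    define t where "t = of_int (- 3) * u"
    have "(t - 1) * (\<Sum>i<n. t ^ i) = t ^ n - 1" by (rule geometric_sum_ring)
    moreover have tk: "t ^ i = of_int ((- 3) ^ i) * u ^ i" for i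
    proof (induction i)
      case (Suc i)
      have "t ^ Suc i = t * (of_int ((- 3) ^ i) * u ^ i)"
        by (simp only: power_Suc Suc)
      also have "\<dots> = of_int ((- 3) ^ i) * (t * u ^ i)"
        by (rule mult_of_int_left_commute)
      also have "\<dots> = of_int ((- 3) ^ i * (- 3)) * (u * u ^ i)"
        by (simp only: t_def of_int_mult mult.assoc)
      also have "\<dots> = of_int ((- 3) ^ Suc i) * u ^ Suc i"
        by (simp only: power_Suc mult.commute[of "(- 3) ^ i"])
      finally show ?case .
    qed simp
    moreover have "t - 1 = - e" by (simp add: t_def e_def)
    ultimately have "e * (\<Sum>i<n. t ^ i) = 1 - of_int ((- 3) ^ n)"
      using n by (metis (no_types, lifting) minus_diff_eq mult.right_neutral mult_minus_left neg_equal_iff_equal)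
    then have "inverse e * (e * (\<Sum>i<n. t ^ i)) = inverse e * of_int (1 - (- 3) ^ n)" by simp
    then have "of_int (1 - (- 3) ^ n) * inverse e = (\<Sum>i<n. t ^ i)"
      using e0 by (metis inverse_mult_cancel_left(1) mult_of_int_commute)
    also have "\<dots> \<in> int_span u n"
      unfolding tk by (intro int_span_sum int_span_scale int_span_power n)
    finally have *: "of_int (1 - (- 3) ^ n) * inverse e \<in> int_span u n" .
    have "3 dvd (- 3 :: int) ^ n" using n by (cases n) auto
    then have "\<not> 3 dvd 1 - (- 3 :: int) ^ n"
      by (simp add: dvd_diff_left_iff)
    with * show ?thesis unfolding R_def by blast
  qed
  then have w: "(u ^ j - u) * inverse e \<in> R"
    using span_R[OF int_span_power[OF n, of j]] span_R[OF int_span_power[OF n, of 1]]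
    by (metis Radd Rneg Rmult diff_conv_add_uminus power_one_right)
  have "g * e * inverse g = 1 + 3 * u ^ j"
    using g(1) gug by (simp add: e_def distrib_left distrib_right mult_3_commute(2)[of g] mult.assoc)
  also have "\<dots> = e + 3 * (u ^ j - u)"
    by (simp add: e_def algebra_simps)
  finally have "g * e * inverse g * inverse e = 1 + 3 * ((u ^ j - u) * inverse e)"
    using e0 by (simp add: distrib_right right_diff_distrib left_diff_distrib mult.assoc)
  then have "(1 + 3 * ((u ^ j - u) * inverse e)) ^ m = 1"
    using m(2) by (simp add: e_def)
  from torsion_eq_1_mod_3[OF R1 Radd Rmult Rneg R3 3 w m(1) this] e0 g(3) show False by simp
qed

section \<open>Positive characteristic\<close>

lemma conjugate_eq_self:
  fixes t c :: "'a::division_ring"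
  assumes "t \<noteq> 0" "t * c = c * t"
  shows "t * c * inverse t = c"
  using assms by (simp add: mult.assoc)

text \<open>Pigeonhole on the exponents, then \<open>b\<close> cancels. \<open>b = 1\<close> handles
  elements of a finite ring, a general \<open>b\<close> an action on a finite set of
  vectors.\<close>

lemma torsion_if_finite_orbit:
  fixes x :: "'a::division_ring"
  assumes x: "x \<noteq> 0" and b: "b \<noteq> 0" and V: "finite V" "\<And>k::nat. x ^ k * b \<in> V"
  shows "\<exists>m>0. x ^ m = 1"
proof -
  have "\<not> inj (\<lambda>k::nat. x ^ k * b)"
    using V by (metis finite_imageD finite_subset image_subsetI infinite_UNIV_nat)
  then obtain k l where kl: "k \<noteq> l" "x ^ k * b = x ^ l * b"
    by (auto simp: inj_def)
  have "\<exists>m>0. x ^ m = 1" if "k < l" "x ^ k * b = x ^ l * b" for k l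
  proof -
    have "x ^ l = x ^ k * x ^ (l - k)" using that by (simp flip: power_add)
    then have "x ^ (l - k) = 1" using that x b by simp
    then show ?thesis using that by (intro exI[of _ "l - k"]) auto
  qed
  from this[of k l] this[of l k] kl show ?thesis by (cases k l rule: linorder_cases) auto
qed

section \<open>Finite subrings and adjunction of torsion elements\<close>

definition is_subring :: "'a::ring_1 set \<Rightarrow> bool" where
  "is_subring C \<longleftrightarrow> 1 \<in> C \<and> (\<forall>x\<in>C. \<forall>y\<in>C. x + y \<in> C \<and> x * y \<in> C) \<and> (\<forall>x\<in>C. - x \<in> C)"

text \<open>A nonzero element of a finite subring has finite order, so its inverse is one of its
  powers.\<close>

lemma finite_subring_division_subring:
  fixes C :: "'a::division_ring set"
  assumes C: "is_subring C" "finite C"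
  shows "is_division_subring C"
  unfolding is_division_subring_def
proof (intro conjI ballI impI)
  have *: "1 \<in> C" "\<And>x y. x \<in> C \<Longrightarrow> y \<in> C \<Longrightarrow> x + y \<in> C" "\<And>x y. x \<in> C \<Longrightarrow> y \<in> C \<Longrightarrow> x * y \<in> C"
    "\<And>x. x \<in> C \<Longrightarrow> - x \<in> C"
    using C by (auto simp: is_subring_def)
  then show "1 \<in> C" "\<And>x y. x \<in> C \<Longrightarrow> y \<in> C \<Longrightarrow> x + y \<in> C" "\<And>x y. x \<in> C \<Longrightarrow> y \<in> C \<Longrightarrow> x * y \<in> C"
    "\<And>x. x \<in> C \<Longrightarrow> - x \<in> C" by auto
  show "0 \<in> C" using *(2)[OF *(1) *(4)[OF *(1)]] by simp
  fix x assume x: "x \<in> C" "x \<noteq> 0"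
  have pow: "x ^ k \<in> C" for k using x * by (induction k) auto
  then obtain m where m: "m > 0" "x ^ m = 1"
    using torsion_if_finite_orbit[OF x(2) one_neq_zero C(2)] by auto
  then have "x * x ^ (m - 1) = 1" by (simp flip: power_Suc)
  then have "inverse x = x ^ (m - 1)" using inverse_unique by blast
  then show "inverse x \<in> C" using pow by simp
qed

text \<open>Since \<open>t\<close> normalizes \<open>C\<close>, coefficients can be moved to the
  left of powers of \<open>t\<close>, and the sums of \<open>c i * t ^ i\<close> with
  \<open>i < m\<close> form a ring. The minimality clause later carries properties of generators
  over to the whole ring.\<close>

lemma finite_subring_adjoin:
  fixes t :: "'a::division_ring"
  assumes C: "is_subring C" "finite C" and m: "m > 0" "t ^ m = 1"
    and conj: "\<And>c. c \<in> C \<Longrightarrow> t * c * inverse t \<in> C"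
  obtains C' where "is_subring C'" "finite C'" "C \<subseteq> C'" "t \<in> C'"
    "\<forall>L. is_division_subring L \<longrightarrow> C \<subseteq> L \<longrightarrow> t \<in> L \<longrightarrow> C' \<subseteq> L"
proof -
  note CD = division_subringD[OF finite_subring_division_subring[OF C]]
  have t0: "t \<noteq> 0" using m by (auto simp: power_0_left)
  define comb where "comb c = (\<Sum>i<m. c i * t ^ i)" for c :: "nat \<Rightarrow> 'a"
  define C' where "C' = comb ` ({..<m} \<rightarrow>\<^sub>E C)"
  have combI: "comb c \<in> C'" if c: "\<And>i. i < m \<Longrightarrow> c i \<in> C" for c
  proof -
    have "comb c = comb (restrict c {..<m})" by (simp add: comb_def)
    moreover have "restrict c {..<m} \<in> {..<m} \<rightarrow>\<^sub>E C" using c by auto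
    ultimately show ?thesis unfolding C'_def by blast
  qed
  have combE: "\<exists>c. (\<forall>i<m. c i \<in> C) \<and> x = comb c" if "x \<in> C'" for x
    using that unfolding C'_def by (auto simp: PiE_iff)
  have add: "x + y \<in> C'" if x: "x \<in> C'" and y: "y \<in> C'" for x y
  proof -
    obtain c d where cd: "\<forall>i<m. c i \<in> C" "x = comb c" "\<forall>i<m. d i \<in> C" "y = comb d"
      using combE[OF x] combE[OF y] by blast
    then have "x + y = comb (\<lambda>i. c i + d i)" by (simp add: comb_def distrib_right sum.distrib)
    then show ?thesis using combI[of "\<lambda>i. c i + d i"] cd CD(3) by simp
  qed
  have neg: "- x \<in> C'" if x: "x \<in> C'" for x
  proof -
    obtain c where c: "\<forall>i<m. c i \<in> C" "x = comb c" using combE[OF x] by blast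
    then have "- x = comb (\<lambda>i. - c i)" by (simp add: comb_def sum_negf)
    then show ?thesis using combI[of "\<lambda>i. - c i"] c CD(5) by simp
  qed
  have mono: "c * t ^ k \<in> C'" if c: "c \<in> C" for c k
  proof -
    have "t ^ k = t ^ (m * (k div m) + k mod m)" by simp
    also have "\<dots> = t ^ (k mod m)" using m by (simp only: power_add power_mult) simp
    finally have "c * t ^ k = comb (\<lambda>i. if i = k mod m then c else 0)"
      using m by (simp add: comb_def if_distrib[of "\<lambda>x. x * _"] cong: if_cong)
    then show ?thesis using combI[of "\<lambda>i. if i = k mod m then c else 0"] c CD(1) by simp
  qed
  have "0 \<in> C'" using mono[OF CD(1), of 0] by simp
  then have sum: "sum f I \<in> C'" if "\<And>i. i \<in> I \<Longrightarrow> f i \<in> C'" for f :: "nat \<Rightarrow> 'a" and I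
    using that by (induction I rule: infinite_finite_induct) (auto intro: add)
  have move: "\<exists>d\<in>C. t ^ i * c = d * t ^ i" if c: "c \<in> C" for c i
  proof (induction i)
    case (Suc i)
    then obtain d where d: "d \<in> C" "t ^ i * c = d * t ^ i" by blast
    have "t ^ Suc i * c = t * d * inverse t * t ^ Suc i"
      using d(2) t0 by (simp add: mult.assoc inverse_mult_cancel_left)
    then show ?case using conj[OF d(1)] by blast
  qed (use c in auto)
  have mult: "x * y \<in> C'" if x: "x \<in> C'" and y: "y \<in> C'" for x y
  proof -
    obtain c d where cd: "\<forall>i<m. c i \<in> C" "x = comb c" "\<forall>i<m. d i \<in> C" "y = comb d"
      using combE[OF x] combE[OF y] by blast
    have "c i * t ^ i * (d j * t ^ j) \<in> C'" if "i < m" "j < m" for i j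
    proof -
      have "d j \<in> C" using cd that by blast
      from move[OF this, of i] obtain d' where d': "d' \<in> C" "t ^ i * d j = d' * t ^ i" by blast
      have "c i * t ^ i * (d j * t ^ j) = c i * (t ^ i * d j) * t ^ j" by (simp only: mult.assoc)
      also have "\<dots> = (c i * d') * t ^ (i + j)" by (simp only: d' power_add mult.assoc)
      finally show ?thesis using mono[of "c i * d'"] cd d' that CD(4) by simp
    qed
    then have "(\<Sum>i<m. \<Sum>j<m. c i * t ^ i * (d j * t ^ j)) \<in> C'" by (intro sum) auto
    then show ?thesis by (simp add: cd comb_def sum_product)
  qed
  have sub: "C \<subseteq> C'" using mono[of _ 0] by auto
  have "t \<in> C'" using mono[OF CD(2), of 1] by simp
  moreover have "is_subring C'"
    unfolding is_subring_def using add mult neg sub CD(2) by blast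
  moreover have "finite C'" unfolding C'_def using C by (intro finite_imageI finite_PiE) auto
  moreover have "C' \<subseteq> L" if L: "is_division_subring L" "C \<subseteq> L" "t \<in> L" for L
  proof
    fix x assume "x \<in> C'"
    then obtain c where c: "\<forall>i<m. c i \<in> C" "x = comb c" using combE by blast
    have "comb c \<in> L" unfolding comb_def
    proof (rule division_subring_sum[OF L(1)])
      fix i assume "i \<in> {..<m}"
      then have "c i \<in> L" using c L(2) by auto
      then show "c i * t ^ i \<in> L" using L(3) by (intro division_subringD[OF L(1)])
    qed
    then show "x \<in> L" using c by simp
  qed
  ultimately show thesis using sub by (intro that[of C']) auto
qed

lemma is_subring_range_of_int: "is_subring (range (of_int :: int \<Rightarrow> 'a::ring_1))"
  unfolding is_subring_def
  by (auto simp flip: of_int_add of_int_mult of_int_minus intro: range_eqI[of _ _ 1])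

lemma finite_range_of_int:
  assumes "p > 0" "of_nat p = (0::'a::ring_1)"
  shows "finite (range (of_int :: int \<Rightarrow> 'a))"
proof -
  have "of_int k = (of_int (k mod int p) :: 'a)" for k
  proof -
    have "(of_int k :: 'a) = of_int (int p * (k div int p) + k mod int p)" by simp
    also have "\<dots> = of_int (k mod int p)" using assms by (simp only: of_int_add of_int_mult) simp
    finally show ?thesis .
  qed
  then have "range (of_int :: int \<Rightarrow> 'a) \<subseteq> of_int ` {0..<int p}"
    using assms(1) by (metis atLeastLessThan_iff image_eqI image_subsetI of_nat_0_less_iff
        pos_mod_bound pos_mod_sign)
  then show ?thesis by (rule finite_subset) auto
qed

lemma range_of_int_subset:
  assumes "is_division_subring L"
  shows "range of_int \<subseteq> L"
proof -
  have "of_nat k \<in> L" for k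
    by (induction k) (auto simp: division_subringD[OF assms])
  then have "of_int k \<in> L" for k
    by (cases k) (auto simp: division_subringD(5)[OF assms] simp del: of_nat_Suc)
  then show ?thesis by auto
qed

text \<open>Adjoin the elements of \<open>T\<close> one by one to the image of the integers;
  commutativity makes each conjugation trivial.\<close>

lemma finite_torsion_subset_finite_subring:
  fixes F :: "'a::division_ring set"
  assumes p: "p > 0" "of_nat p = (0::'a)" and F: "is_division_subring F"
    and comm: "\<And>x y. x \<in> F \<Longrightarrow> y \<in> F \<Longrightarrow> x * y = y * x"
    and tors: "\<And>x. x \<in> F \<Longrightarrow> x \<noteq> 0 \<Longrightarrow> \<exists>m>0. x ^ m = 1"
    and T: "finite T" "T \<subseteq> F"
  shows "\<exists>C. is_subring C \<and> finite C \<and> T \<subseteq> C \<and> C \<subseteq> F"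
  using T
proof (induction T)
  case empty
  show ?case
    using is_subring_range_of_int finite_range_of_int[OF p] range_of_int_subset[OF F] by blast
next
  case (insert t T)
  then obtain C where C: "is_subring C" "finite C" "T \<subseteq> C" "C \<subseteq> F" by auto
  show ?case
  proof (cases "t = 0")
    case True
    then show ?thesis
      using C division_subringD(1)[OF finite_subring_division_subring[OF C(1,2)]] by blast
  next
    case False
    then obtain m where m: "m > 0" "t ^ m = 1" using tors insert.prems by blast
    have conj: "t * c * inverse t \<in> C" if "c \<in> C" for c
    proof -
      have "t * c * inverse t = c"
        using comm[of t c] that C(4) insert.prems False by (intro conjugate_eq_self) auto
      then show ?thesis using that by simp
    qed
    obtain C' where "is_subring C'" "finite C'" "C \<subseteq> C'" "t \<in> C'"
      "\<forall>L. is_division_subring L \<longrightarrow> C \<subseteq> L \<longrightarrow> t \<in> L \<longrightarrow> C' \<subseteq> L"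
      by (rule finite_subring_adjoin[OF C(1,2) m conj])
    then show ?thesis using C F insert.prems by (intro exI[of _ C']) auto
  qed
qed

text \<open>The finitely many coefficients describing multiplication by \<open>g\<close> on
  \<open>B\<close> lie in a finite field \<open>C\<close> inside the center. The
  \<open>C\<close>-combinations of \<open>B\<close> form a finite set stable under \<open>g\<close>,
  so \<open>g\<close> has finite orbits on it.\<close>

lemma torsion_over_torsion_center:
  fixes K :: "'a::division_ring set"
  assumes p: "p > 0" "of_nat p = (0::'a)" and K: "is_division_subring K" and fd: "fin_dim_over_center K"
    and tors: "\<And>x. x \<in> rel_center K \<Longrightarrow> x \<noteq> 0 \<Longrightarrow> \<exists>m>0. x ^ m = 1"
    and g: "g \<in> K" "g \<noteq> 0"
  shows "\<exists>m>0. g ^ m = 1"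
proof -
  note KD = division_subringD[OF K]
  define F where "F = rel_center K"
  have F: "is_division_subring F" unfolding F_def by (rule division_subring_rel_center[OF K])
  obtain B where B: "finite B" "B \<subseteq> K"
    and span: "\<And>x. x \<in> K \<Longrightarrow> \<exists>c. (\<forall>b\<in>B. c b \<in> F) \<and> x = (\<Sum>b\<in>B. c b * b)"
    using fd unfolding fin_dim_over_center_def F_def by blast
  have "\<forall>b\<in>B. \<exists>c. (\<forall>b'\<in>B. c b' \<in> F) \<and> g * b = (\<Sum>b'\<in>B. c b' * b')"
    using span KD(4)[OF g(1)] B(2) by blast
  then obtain c where c: "\<And>b b'. b \<in> B \<Longrightarrow> b' \<in> B \<Longrightarrow> c b b' \<in> F"
    "\<And>b. b \<in> B \<Longrightarrow> g * b = (\<Sum>b'\<in>B. c b b' * b')"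
    using bchoice[of B "\<lambda>b c. (\<forall>b'\<in>B. c b' \<in> F) \<and> g * b = (\<Sum>b'\<in>B. c b' * b')"] by blast
  have "\<exists>C. is_subring C \<and> finite C \<and> (\<lambda>(b, b'). c b b') ` (B \<times> B) \<subseteq> C \<and> C \<subseteq> F"
    using B(1) c(1) tors rel_center_subset[of K]
    by (intro finite_torsion_subset_finite_subring[OF p F]) (auto simp: F_def rel_center_commute subset_eq)
  then obtain C where C: "is_subring C" "finite C" "\<And>b b'. b \<in> B \<Longrightarrow> b' \<in> B \<Longrightarrow> c b b' \<in> C" "C \<subseteq> F"
    by auto
  have CF: "is_division_subring C" by (rule finite_subring_division_subring[OF C(1,2)])
  define V where "V = (\<lambda>f. \<Sum>b\<in>B. f b * b) ` (B \<rightarrow>\<^sub>E C)"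
  have VI: "(\<Sum>b\<in>B. f b * b) \<in> V" if "\<And>b. b \<in> B \<Longrightarrow> f b \<in> C" for f
  proof -
    have "(\<Sum>b\<in>B. f b * b) = (\<Sum>b\<in>B. restrict f B b * b)" by simp
    moreover have "restrict f B \<in> B \<rightarrow>\<^sub>E C" using that by auto
    ultimately show ?thesis unfolding V_def by blast
  qed
  have gV: "g * x \<in> V" if x: "x \<in> V" for x
  proof -
    obtain f where f: "\<And>b. b \<in> B \<Longrightarrow> f b \<in> C" "x = (\<Sum>b\<in>B. f b * b)"
      using x unfolding V_def by (auto simp: PiE_iff)
    have "g * x = (\<Sum>b\<in>B. f b * (g * b))"
      unfolding f(2) sum_distrib_left
    proof (intro sum.cong refl)
      fix b assume "b \<in> B"
      then have "f b * g = g * f b"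
        using f(1) C(4) g(1) rel_center_commute[of "f b" K g] by (auto simp: F_def)
      then show "g * (f b * b) = f b * (g * b)" by (metis mult.assoc)
    qed
    also have "\<dots> = (\<Sum>b\<in>B. \<Sum>b'\<in>B. f b * c b b' * b')"
      by (intro sum.cong refl) (simp add: c(2) sum_distrib_left mult.assoc)
    also have "\<dots> = (\<Sum>b'\<in>B. (\<Sum>b\<in>B. f b * c b b') * b')"
      by (subst sum.swap) (simp add: sum_distrib_right)
    also have "\<dots> \<in> V"
      by (intro VI division_subring_sum[OF CF] division_subringD(4)[OF CF] f C(3))
    finally show ?thesis .
  qed
  obtain b where b: "b \<in> B" "b \<noteq> 0"
  proof -
    obtain d where "1 = (\<Sum>b\<in>B. d b * b)" using span[OF KD(2)] by blast
    then have "\<exists>b\<in>B. b \<noteq> 0" by (metis (no_types, lifting) mult_zero_right sum.neutral zero_neq_one)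
    then show thesis using that by blast
  qed
  have "b = (\<Sum>b'\<in>B. (if b' = b then 1 else 0) * b')"
    using B(1) b(1) by (simp add: if_distrib[of "\<lambda>x. x * _"] cong: if_cong)
  also have "\<dots> \<in> V"
    using division_subringD(1,2)[OF CF] by (intro VI) auto
  finally have "b \<in> V" .
  then have "g ^ k * b \<in> V" for k
    by (induction k) (auto simp: mult.assoc gV)
  moreover have "finite V" unfolding V_def using B(1) C(2) by (intro finite_imageI finite_PiE) auto
  ultimately show ?thesis using torsion_if_finite_orbit[OF g(2) b(2)] by blast
qed

text \<open>Three finite rings occur: \<open>C\<close>, generated by \<open>u\<close>;
  \<open>E\<close>, generated by \<open>C\<close> and a root of unity \<open>y\<close>, which shows
  that a given central \<open>z\<close> is torsion; and \<open>A\<close>, generated by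
  \<open>C\<close> and \<open>g\<close>, which contradicts Wedderburn's theorem.\<close>

lemma char_p_contradiction:
  fixes u g :: "'a::division_ring"
  assumes p: "p > 0" "of_nat p = (0::'a)" and K: "is_division_subring K" and fd: "fin_dim_over_center K"
    and tors: "\<And>a b. a \<in> K \<Longrightarrow> b \<in> K \<Longrightarrow> a \<noteq> 0 \<Longrightarrow> b \<noteq> 0 \<Longrightarrow> \<exists>m>0. (a * b * inverse a * inverse b) ^ m = 1"
    and u: "u \<in> K" "n > 0" "u ^ n = 1"
    and g: "g \<in> K" "g \<noteq> 0" "g * u = u ^ j * g" "u ^ j \<noteq> u"
  shows False
proof -
  note KD = division_subringD[OF K]
  have u0: "u \<noteq> 0" using u by (auto simp: power_0_left)
  have gug: "g * u * inverse g = u ^ j" using g by (simp add: mult.assoc)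
  have conj0: "u * c * inverse u \<in> range of_int" if "c \<in> range of_int" for c
    using that u0 by (auto simp: conjugate_eq_self mult_of_int_commute)
  obtain C where C: "is_subring C" "finite C" "range of_int \<subseteq> C" "u \<in> C"
    "\<forall>L. is_division_subring L \<longrightarrow> range of_int \<subseteq> L \<longrightarrow> u \<in> L \<longrightarrow> C \<subseteq> L"
    by (rule finite_subring_adjoin[OF is_subring_range_of_int finite_range_of_int[OF p] u(2,3) conj0])
  \<comment> \<open>Minimality of \<open>C\<close> reduces containment in a division subring to
    membership of \<open>u\<close>.\<close>
  have CL: "C \<subseteq> L" if "is_division_subring L" "u \<in> L" for L
    using C(5) that range_of_int_subset by blast
  have C': "is_division_subring C" by (rule finite_subring_division_subring[OF C(1,2)])
  have UNIV: "is_division_subring (UNIV :: 'a set)" by (simp add: is_division_subring_def)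
  have "\<exists>m>0. z ^ m = 1" if z: "z \<in> rel_center K" "z \<noteq> 0" for z
  proof -
    have zc: "z * x = x * z" if "x \<in> K" for x using z(1) that by (rule rel_center_commute)
    have zK: "z \<in> K" using z(1) rel_center_subset by blast
    define e where "e = z + u"
    have eK: "e \<in> K" unfolding e_def by (intro KD zK u)
    have e0: "e \<noteq> 0"
    proof
      assume "e = 0"
      then have "u = - z" by (simp add: e_def eq_neg_iff_add_eq_0 add.commute)
      then have "g * u = u * g" using zc[OF g(1)] by simp
      with g show False by simp
    qed
    define y where "y = g * e * inverse g * inverse e"
    obtain m where m: "m > 0" "y ^ m = 1" using tors[OF g(1) eK g(2) e0] unfolding y_def by blast
    have "g * e * inverse g = z + u ^ j"
      using gug conjugate_eq_self[OF g(2) zc[OF g(1), symmetric]] by (simp add: e_def distrib_left distrib_right)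
    then have ye: "y * e = z + u ^ j"
      using e0 by (simp add: y_def mult.assoc)
    have y1: "y \<noteq> 1" using ye g(4) by (auto simp: e_def)
    have yu: "u * y = y * u"
    proof -
      have 1: "e * u = u * e" using zc[OF u(1)] by (simp add: e_def distrib_left distrib_right)
      have "y = (z + u ^ j) * inverse e" using ye e0 by (metis mult.assoc mult.right_neutral right_inverse)
      moreover have "u * (z + u ^ j) = (z + u ^ j) * u"
        using zc[OF u(1)] by (simp add: distrib_left distrib_right power_commutes)
      ultimately show ?thesis
        using inverse_commute[OF 1] by (metis mult.assoc)
    qed
    \<comment> \<open>The centralizer of \<open>y\<close> contains \<open>u\<close>, hence
      \<open>C\<close>; so \<open>y\<close> normalizes \<open>C\<close> and can be adjoined.\<close>
    have "C \<subseteq> {x \<in> UNIV. \<forall>t\<in>{y}. x * t = t * x}"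
      by (rule CL[OF division_subring_centralizer[OF UNIV]]) (simp add: yu)
    moreover have "y \<noteq> 0" using m by (auto simp: power_0_left)
    ultimately have conj1: "y * c * inverse y \<in> C" if "c \<in> C" for c
      using that conjugate_eq_self[of y c] by (auto simp: subset_eq)
    obtain E where E: "is_subring E" "finite E" "C \<subseteq> E" "y \<in> E"
      by (rule finite_subring_adjoin[OF C(1,2) m conj1])
    note ED = division_subringD[OF finite_subring_division_subring[OF E(1,2)]]
    \<comment> \<open>Solve \<open>y * (z + u) = z + u ^ j\<close> for \<open>z\<close>; this is
      possible because \<open>y \<noteq> 1\<close>.\<close>
    have "(y - 1) * z = u ^ j - y * u"
      using ye by (simp add: e_def distrib_left left_diff_distrib algebra_simps)
    then have "z = inverse (y - 1) * (u ^ j - y * u)"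
      using y1 inverse_mult_cancel_left(1)[of "y - 1" z] by simp
    also have "\<dots> \<in> E" using E C(4) by (intro ED) auto
    finally have "z ^ k * 1 \<in> E" for k by (simp add: ED)
    from torsion_if_finite_orbit[OF z(2) one_neq_zero E(2) this] show ?thesis .
  qed
  from torsion_over_torsion_center[OF p K fd this g(1,2)] obtain k where k: "k > 0" "g ^ k = 1"
    by blast
  note CD = division_subringD[OF C']
  \<comment> \<open>The preimage of \<open>C\<close> under conjugation by \<open>g\<close> is a
    division subring. It contains \<open>u\<close>, which is sent to \<open>u ^ j\<close>, and
    therefore all of \<open>C\<close>.\<close>
  have L: "is_division_subring {x. g * x * inverse g \<in> C}"
  proof -
    have 1: "g * (x * y) * inverse g = (g * x * inverse g) * (g * y * inverse g)" for x y
      using g(2) by (simp add: mult.assoc inverse_mult_cancel_left)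
    have 2: "g * inverse x * inverse g = inverse (g * x * inverse g)" if "x \<noteq> 0" for x
      using g(2) that by (simp add: nonzero_inverse_mult_distrib mult.assoc)
    have 3: "g * (x + y) * inverse g = g * x * inverse g + g * y * inverse g" for x y
      by (simp add: distrib_left distrib_right)
    show ?thesis
      unfolding is_division_subring_def mem_Collect_eq using g(2) by (auto simp only: 1 3) (auto intro: CD, metis 2 CD(6))
  qed
  have "C \<subseteq> {x. g * x * inverse g \<in> C}"
    by (rule CL[OF L]) (use gug CD(8)[OF C(4)] in simp)
  then have conj2: "g * c * inverse g \<in> C" if "c \<in> C" for c using that by blast
  obtain A where A: "is_subring A" "finite A" "C \<subseteq> A" "g \<in> A"
    by (rule finite_subring_adjoin[OF C(1,2) k conj2])
  have "g * u = u * g"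
    using wedderburn_little[OF finite_subring_division_subring[OF A(1,2)] A(2) A(4)] A(3) C(4) by blast
  with g show False by simp
qed

section \<open>From two non-commuting elements to a contradiction\<close>

lemma division_subring_gen:
  "is_division_subring (div_subring_gen S)" "S \<subseteq> div_subring_gen S"
  by (auto simp: div_subring_gen_def is_division_subring_def)

theorem theorem6p3:
  assumes "weakly_locally_finite TYPE('a::division_ring)"
    and "\<forall>a b::'a. a \<noteq> 0 \<longrightarrow> b \<noteq> 0 \<longrightarrow>
           (\<exists>n::nat. n > 0 \<and> (a * b * inverse a * inverse b) ^ n \<in> center)"
  shows "\<forall>x y::'a. x * y = y * x"
proof (intro allI, rule ccontr)
  fix x y :: 'a
  assume nc: "x * y \<noteq> y * x"
  define K where "K = div_subring_gen {x, y}"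
  have K: "is_division_subring K" and xy: "x \<in> K" "y \<in> K"
    using division_subring_gen[of "{x, y}"] by (auto simp: K_def)
  have fd: "fin_dim_over_center K"
    using assms(1) by (simp add: weakly_locally_finite_def K_def)
  note KD = division_subringD[OF K]
  have tors: "\<exists>m>0. (a * b * inverse a * inverse b) ^ m = 1"
    if ab: "a \<in> K" "b \<in> K" "a \<noteq> 0" "b \<noteq> 0" for a b
  proof -
    obtain n where n: "n > 0" "(a * b * inverse a * inverse b) ^ n \<in> center"
      using assms(2) ab by blast
    \<comment> \<open>Elements of \<open>K\<close> that are central in the whole ring are central in
      \<open>K\<close>.\<close>
    moreover have "(a * b * inverse a * inverse b) ^ n \<in> K"
      by (intro KD ab)
    ultimately have "(a * b * inverse a * inverse b) ^ n \<in> rel_center K"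
      by (auto simp: center_def rel_center_def)
    with central_commutator_power_torsion[OF K fd ab n(1)] show ?thesis .
  qed
  have x0: "x \<noteq> 0" using nc by auto
  obtain b where b: "b \<in> K" "b \<noteq> 0" "x * b * inverse x * inverse b \<notin> rel_center K"
    using ex_noncentral_commutator[OF K xy nc] by blast
  define u where "u = x * b * inverse x * inverse b"
  have u: "u \<in> K" "u \<notin> rel_center K"
    using b by (auto simp: u_def intro!: KD xy)
  obtain n where n: "n > 0" "u ^ n = 1"
    using tors[OF xy(1) b(1) x0 b(2)] by (auto simp: u_def)
  obtain g j where g: "g \<in> K" "g \<noteq> 0" "g * u = u ^ j * g" "u ^ j \<noteq> u"
    using torsion_conjugate_to_power[OF K u n] by blast
  show False
  proof (cases "\<exists>p>0. of_nat p = (0::'a)")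
    case True
    then obtain p where "p > 0" "of_nat p = (0::'a)" by blast
    from char_p_contradiction[OF this K fd tors u(1) n g] show False .
  next
    case False
    have char0: "k = 0" if "of_int k = (0::'a)" for k
    proof (cases k rule: int_cases2)
      case (nonneg m)
      with that have "of_nat m = (0::'a)" by simp
      with False nonneg show ?thesis by auto
    next
      case (nonpos m)
      with that have "of_nat m = (0::'a)" by simp
      with False nonpos show ?thesis by auto
    qed
    have "3 * u = of_int 3 * u" by simp
    also have "\<dots> \<in> K" using range_of_int_subset[OF K] by (intro KD u) blast
    finally have e: "1 + 3 * u \<in> K" by (intro KD(2,3))
    \<comment> \<open>Otherwise \<open>3 * u = - 1\<close> would make \<open>u\<close> commute with
      \<open>g\<close>.\<close>
    have e0: "1 + 3 * u \<noteq> 0"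
    proof
      assume "1 + 3 * u = 0"
      then have "3 * u = - 1" by (simp add: eq_neg_iff_add_eq_0 add.commute)
      then have "3 * (g * u) = 3 * (u * g)"
        by (metis mult.assoc mult_3_commute(2) mult_1_left mult_1_right mult_minus_left mult_minus_right)
      moreover have "(3::'a) \<noteq> 0" using char0[of 3] by auto
      ultimately have "g * u = u * g" by simp
      with g show False by simp
    qed
    from tors[OF g(1) e g(2) e0] obtain m
      where "m > 0" "(g * (1 + 3 * u) * inverse g * inverse (1 + 3 * u)) ^ m = 1" by blast
    from char_0_contradiction[OF char0 n g(2-4) e0 this] show False .
  qed
qed

end
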